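(* For every oriented matroid $\mathcal{M}$, its tope graph has a reconstructible map; consequently the class of topes $\mathcal{T}(\mathcal{M})$ has a proper unlabeled sample compression scheme of size $\mathrm{vc}(\mathcal{T}(\mathcal{M}))$.
   Context: OM: $(U,\mathcal{L})$, $\mathcal{L}\subseteq\{+,-,0\}^U$, satisfying (C) $X\circ Y\in\mathcal{L}$; (SE) for $X,Y\in\mathcal{L}$, $e\in\mathrm{Sep}(X,Y)$ there is $Z\in\mathcal{L}$ with $Z_e=0$ and $Z_h=(X\circ Y)_h$ for $h\notin\mathrm{Sep}(X,Y)$; (Sym) $-X\in\mathcal{L}$; where $\mathrm{Sep}(X,Y)=\{e:\{X_e,Y_e\}=\{+,-\}\}$ and $(X\circ Y)_e=X_e$ if $X_e\ne0$, else $Y_e$. OMs are assumed simple. Topes: $\mathcal{T}(\mathcal{M})=\mathcal{L}\cap\{+,-\}^U$; the tope graph is the induced subgraph of the hypercube on the topes (a partial cube). For a partial cube $G$ with vertices in $\{+,-\}^U$: halfspaces $H_e^\pm$; convex sets (containing all shortest paths; equivalently intersections of halfspaces) form $\mathcal{H}(G)$; $\mathrm{osc}(C)$ is the set of elements flipped by edges between $C$ and its complement; $\overline{X}(G)$ is the family of subsets of $U$ shattered by the vertex set; $\mathrm{vc}$ is the VC-dimension. A reconstructible map is $a:\mathcal{H}(G)\to\overline{X}(G)$ with (a) $a(C)\subseteq\mathrm{osc}(C)$ and (b) for each $V$ in the image, $\bigcap\{C: a(C)=V\}\ne\emptyset$. For a concept class $\mathcal{C}\subseteq\{+,-\}^U$: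 samples $s\in\{+,-,0\}^U$, support $\underline{s}=\{u:s_u\ne0\}$, realizable if $s\le c$ for some $c\in\mathcal{C}$ (product order from $0\le+,0\le-$), set $\mathrm{RS}(\mathcal{C})$. An unlabeled sample compression scheme of size $k$: maps $\alpha:\mathrm{RS}(\mathcal{C})\to\{A\subseteq U:|A|\le k\}$ and $\beta:\alpha(\mathrm{RS}(\mathcal{C}))\to\{+,-\}^U$ with $\alpha(s)\subseteq\underline{s}$ and $s\le\beta(\alpha(s))$; proper if $\beta$ maps into $\mathcal{C}$. *)

theory Defs
  imports Main
begin

datatype sign = Plus | Minus | Zero

instantiation sign :: uminus
begin

fun uminus_sign :: "sign \<Rightarrow> sign" where
  "- Plus = Minus"
| "- Minus = Plus"
| "- Zero = Zero"

instance ..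

end

instantiation sign :: order
begin

definition less_eq_sign :: "sign \<Rightarrow> sign \<Rightarrow> bool" where
  "x \<le> y \<longleftrightarrow> x = Zero \<or> x = (y :: sign)"

definition less_sign :: "sign \<Rightarrow> sign \<Rightarrow> bool" where
  "x < y \<longleftrightarrow> x \<le> y \<and> x \<noteq> (y :: sign)"

instance
  by standard (auto simp: less_eq_sign_def less_sign_def)

end

text \<open>
  A sign vector on the ground set \<open>U\<close> is a function that is \<open>Zero\<close> off \<open>U\<close>. Each element of
  \<open>{+,-,0}\<^sup>U\<close> thus has exactly one representative; negation and the product order are the
  pointwise operations of the function type.
\<close>

definition support :: "('a \<Rightarrow> sign) \<Rightarrow> 'a set" where
  "support X = {e. X e \<noteq> Zero}"

definition sign_vectors :: "'a set \<Rightarrow> ('a \<Rightarrow> sign) set" where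
  "sign_vectors U = {X. support X \<subseteq> U}"

definition full_sign_vectors :: "'a set \<Rightarrow> ('a \<Rightarrow> sign) set" where
  "full_sign_vectors U = {X. support X = U}"

definition Sep :: "('a \<Rightarrow> sign) \<Rightarrow> ('a \<Rightarrow> sign) \<Rightarrow> 'a set" where
  "Sep X Y = {e. {X e, Y e} = {Plus, Minus}}"

definition composition :: "('a \<Rightarrow> sign) \<Rightarrow> ('a \<Rightarrow> sign) \<Rightarrow> 'a \<Rightarrow> sign" where
  "composition X Y = (\<lambda>e. if X e \<noteq> Zero then X e else Y e)"

locale oriented_matroid =
  fixes U :: "'a set" and L :: "('a \<Rightarrow> sign) set"
  assumes finite_ground: "finite U"
    and covectors: "L \<subseteq> sign_vectors U"
    and comp_closed: "\<lbrakk>X \<in> L; Y \<in> L\<rbrakk> \<Longrightarrow> composition X Y \<in> L"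
    and strong_elimination: "\<lbrakk>X \<in> L; Y \<in> L; e \<in> Sep X Y\<rbrakk> \<Longrightarrow>
      \<exists>Z\<in>L. Z e = Zero \<and> (\<forall>h\<in>U - Sep X Y. Z h = composition X Y h)"
    and symmetric: "X \<in> L \<Longrightarrow> - X \<in> L"

locale simple_oriented_matroid = oriented_matroid +
  assumes no_loops: "e \<in> U \<Longrightarrow> \<not> (\<forall>X\<in>L. X e = Zero)"
    and no_parallel: "\<lbrakk>e \<in> U; f \<in> U; e \<noteq> f\<rbrakk> \<Longrightarrow>
      \<not> (\<forall>X\<in>L. X e = X f) \<and> \<not> (\<forall>X\<in>L. X e = - X f)"

definition topes :: "'a set \<Rightarrow> ('a \<Rightarrow> sign) set \<Rightarrow> ('a \<Rightarrow> sign) set" where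
  "topes U L = L \<inter> full_sign_vectors U"

text \<open>
  An induced subgraph of the hypercube on \<open>{+,-}\<^sup>U\<close> is given by its vertex set \<open>V\<close>. Walks are
  nonempty vertex lists; a walk of minimal length between its ends is a shortest path.
\<close>

definition cube_adj :: "('a \<Rightarrow> sign) \<Rightarrow> ('a \<Rightarrow> sign) \<Rightarrow> bool" where
  "cube_adj X Y \<longleftrightarrow> (\<exists>!e. X e \<noteq> Y e)"

definition walk :: "('a \<Rightarrow> sign) set \<Rightarrow> ('a \<Rightarrow> sign) list \<Rightarrow> bool" where
  "walk V p \<longleftrightarrow> p \<noteq> [] \<and> set p \<subseteq> V \<and> successively cube_adj p"

definition shortest_path :: "('a \<Rightarrow> sign) set \<Rightarrow> ('a \<Rightarrow> sign) list \<Rightarrow> bool" where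
  "shortest_path V p \<longleftrightarrow> walk V p \<and>
    (\<forall>q. walk V q \<and> hd q = hd p \<and> last q = last p \<longrightarrow> length p \<le> length q)"

text \<open>
  The empty set is excluded: its \<open>osc\<close> is empty, as is that of the whole vertex set, so with it
  no map could satisfy both conditions on a reconstructible map.
\<close>

definition convex_sets :: "('a \<Rightarrow> sign) set \<Rightarrow> ('a \<Rightarrow> sign) set set" where
  "convex_sets V = {C. C \<noteq> {} \<and> C \<subseteq> V \<and>
    (\<forall>p. shortest_path V p \<and> hd p \<in> C \<and> last p \<in> C \<longrightarrow> set p \<subseteq> C)}"

definition osc :: "('a \<Rightarrow> sign) set \<Rightarrow> ('a \<Rightarrow> sign) set \<Rightarrow> 'a set" where
  "osc V C = {e. \<exists>X\<in>C. \<exists>Y\<in>V - C. cube_adj X Y \<and> X e \<noteq> Y e}"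

definition shattered_sets :: "'a set \<Rightarrow> ('a \<Rightarrow> sign) set \<Rightarrow> 'a set set" where
  "shattered_sets U V =
    {A. A \<subseteq> U \<and> (\<forall>Y\<in>full_sign_vectors A. \<exists>X\<in>V. \<forall>e\<in>A. X e = Y e)}"

definition vc_dim :: "'a set \<Rightarrow> ('a \<Rightarrow> sign) set \<Rightarrow> nat" where
  "vc_dim U V = Max (card ` shattered_sets U V)"

definition reconstructible_map ::
  "'a set \<Rightarrow> ('a \<Rightarrow> sign) set \<Rightarrow> (('a \<Rightarrow> sign) set \<Rightarrow> 'a set) \<Rightarrow> bool" where
  "reconstructible_map U V a \<longleftrightarrow>
    (\<forall>C\<in>convex_sets V. a C \<in> shattered_sets U V) \<and>
    (\<forall>C\<in>convex_sets V. a C \<subseteq> osc V C) \<and>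
    (\<forall>W\<in>a ` convex_sets V. \<Inter>{C \<in> convex_sets V. a C = W} \<noteq> {})"

definition realizable_samples ::
  "'a set \<Rightarrow> ('a \<Rightarrow> sign) set \<Rightarrow> ('a \<Rightarrow> sign) set" where
  "realizable_samples U \<C> = {s \<in> sign_vectors U. \<exists>c\<in>\<C>. s \<le> c}"

definition unlabeled_compression_scheme ::
  "'a set \<Rightarrow> ('a \<Rightarrow> sign) set \<Rightarrow> nat \<Rightarrow>
    (('a \<Rightarrow> sign) \<Rightarrow> 'a set) \<Rightarrow> ('a set \<Rightarrow> 'a \<Rightarrow> sign) \<Rightarrow> bool" where
  "unlabeled_compression_scheme U \<C> k \<alpha> \<beta> \<longleftrightarrow>
    (\<forall>s\<in>realizable_samples U \<C>. \<alpha> s \<subseteq> U \<and> card (\<alpha> s) \<le> k) \<and>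
    (\<forall>A\<in>\<alpha> ` realizable_samples U \<C>. \<beta> A \<in> full_sign_vectors U) \<and>
    (\<forall>s\<in>realizable_samples U \<C>. \<alpha> s \<subseteq> support s \<and> s \<le> \<beta> (\<alpha> s))"

definition proper_unlabeled_compression_scheme ::
  "'a set \<Rightarrow> ('a \<Rightarrow> sign) set \<Rightarrow> nat \<Rightarrow>
    (('a \<Rightarrow> sign) \<Rightarrow> 'a set) \<Rightarrow> ('a set \<Rightarrow> 'a \<Rightarrow> sign) \<Rightarrow> bool" where
  "proper_unlabeled_compression_scheme U \<C> k \<alpha> \<beta> \<longleftrightarrow>
    unlabeled_compression_scheme U \<C> k \<alpha> \<beta> \<and>
    (\<forall>A\<in>\<alpha> ` realizable_samples U \<C>. \<beta> A \<in> \<C>)"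

end

theory Submission
  imports Defs
begin

text \<open>
  A convex set of topes is the set of all topes above a sample supported on its osculating elements,
  so it suffices to compress samples: to choose for every realizable sample \<open>s\<close> a shattered set
  \<open>W\<close> inside its support and a covector above \<open>s\<close> that depends on \<open>W\<close> only.

  This is done by linear programming in oriented matroids. Add a generic element \<open>f\<close> by a
  lexicographic extension. If the cone of \<open>s\<close> meets the side \<open>f > 0\<close>, either it reaches suitably to
  infinity, that is, into the section \<open>f = 0\<close> of smaller rank, or a generic objective attains its
  maximum over the cone at a vertex \<open>p\<close> of the affine space \<open>f = 1\<close>; then a basis \<open>W\<close> of the zero set
  of \<open>p\<close> determines \<open>p\<close>. If the cone lies in \<open>f < 0\<close>, the objective is the least element \<open>e\<close> of the
  support, which can be read off as the least element of \<open>W\<close>. Either way \<open>W\<close> and the covector are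
  completed in the localisation at \<open>p\<close>, whose cone lies on one side of the objective. The sets
  arising in different cases are distinguished by whether they span.
\<close>

section \<open>Sign vectors\<close>

text \<open>The decoder sees \<open>W\<close> without signs, so every choice of the encoder must be
  readable from an unsigned set. A point can be named this way: if \<open>W\<close> spans the
  section \<open>f = 0\<close>, two covectors that vanish on \<open>W\<close> and have the same
  nonzero sign at \<open>f\<close> differ by a direction of that section vanishing on
  \<open>W\<close>, hence coincide. The sign at \<open>f\<close> must therefore be fixed in advance,
  which forces the split by the side of \<open>f\<close>. In the localisation at \<open>p\<close>
  the same situation returns with the objective in place of \<open>f\<close>: optimality of
  \<open>p\<close> prescribes the sign of all nonzero limits there. Genericity is what turns the
  absence of improving directions into the statement that every nonzero direction of the cone is
  strictly worse, so that the optimum is a single point. A sample reaching to infinity is passed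
  down the chain of successive sections; the level where it is treated is the first one spanned by
  \<open>W\<close>, which the decoder can test.\<close>

lemma sign_uminus_uminus [simp]: "- (- x) = (x::sign)"
  by (cases x) auto

lemma sign_uminus_eq_Zero [simp]: "- x = Zero \<longleftrightarrow> x = Zero"
  by (cases x) auto

lemma Zero_eq_sign_uminus [simp]: "Zero = - x \<longleftrightarrow> x = Zero"
  by (cases x) auto

lemma sign_eq_uminus_self [simp]: "x = - x \<longleftrightarrow> x = (Zero::sign)"
  by (cases x) auto

lemma sign_uminus_self_eq [simp]: "- x = x \<longleftrightarrow> x = (Zero::sign)"
  by (cases x) auto

lemma sign_uminus_inject [simp]: "- x = - y \<longleftrightarrow> x = (y::sign)"
  by (cases x; cases y) auto

lemma sign_trichotomy: "s \<noteq> Zero \<Longrightarrow> x = Zero \<or> x = s \<or> x = - s"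
  by (cases x; cases s) auto

lemma in_Sep_iff: "e \<in> Sep X Y \<longleftrightarrow> X e \<noteq> Zero \<and> Y e = - X e"
  unfolding Sep_def by (cases "X e"; cases "Y e") (auto simp: doubleton_eq_iff)

lemma le_sign_vector_iff: "(X :: 'a \<Rightarrow> sign) \<le> Y \<longleftrightarrow> (\<forall>h. X h \<noteq> Zero \<longrightarrow> Y h = X h)"
  unfolding le_fun_def less_eq_sign_def by metis

abbreviation zero_vector :: "'a \<Rightarrow> sign" where
  "zero_vector \<equiv> \<lambda>_. Zero"

text \<open>While \<open>s \<le> X\<close> describes the open cone of the sample, this is its
  closure: \<open>X\<close> may also vanish on the support of \<open>s\<close>. Its members are the
  limits of the sample.\<close>

definition agrees :: "('a \<Rightarrow> sign) \<Rightarrow> ('a \<Rightarrow> sign) \<Rightarrow> bool" where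
  "agrees s X \<longleftrightarrow> (\<forall>h. s h \<noteq> Zero \<longrightarrow> X h \<noteq> - s h)"

definition restr :: "'a set \<Rightarrow> ('a \<Rightarrow> sign) \<Rightarrow> 'a \<Rightarrow> sign" where
  "restr G X = (\<lambda>h. if h \<in> G then X h else Zero)"

text \<open>For the covectors of an oriented matroid, \<open>spans\<close> and
  \<open>shatters\<close> single out the spanning and the independent sets of the underlying
  matroid.\<close>

definition spans :: "('a \<Rightarrow> sign) set \<Rightarrow> 'a set \<Rightarrow> bool" where
  "spans L W \<longleftrightarrow> (\<forall>X\<in>L. (\<forall>w\<in>W. X w = Zero) \<longrightarrow> X = zero_vector)"

definition shatters :: "('a \<Rightarrow> sign) set \<Rightarrow> 'a set \<Rightarrow> bool" where
  "shatters L W \<longleftrightarrow> (\<forall>t. (\<forall>w\<in>W. t w \<noteq> Zero) \<longrightarrow> (\<exists>X\<in>L. \<forall>w\<in>W. X w = t w))"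

lemma composition_apply: "composition X Y e = (if X e \<noteq> Zero then X e else Y e)"
  by (simp add: composition_def)

lemma agrees_if_le: "s \<le> X \<Longrightarrow> agrees s X"
  by (auto simp: agrees_def le_sign_vector_iff)

lemma le_composition: "agrees s X \<Longrightarrow> s \<le> Y \<Longrightarrow> s \<le> composition X Y"
  unfolding agrees_def le_sign_vector_iff composition_def
  by (metis sign_trichotomy)

section \<open>Minors and linear programming\<close>

context oriented_matroid
begin

lemma covector_off_ground: "X \<in> L \<Longrightarrow> h \<notin> U \<Longrightarrow> X h = Zero"
  using covectors by (auto simp: sign_vectors_def support_def)

lemma elimination:
  assumes "X \<in> L" "Y \<in> L" "X e \<noteq> Zero" "Y e = - X e"
  obtains Z where "Z \<in> L" "Z e = Zero"
    "\<And>h. X h = Zero \<or> Y h \<noteq> - X h \<Longrightarrow> Z h = (if X h \<noteq> Zero then X h else Y h)"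
proof -
  obtain Z where Z: "Z \<in> L" "Z e = Zero" "\<forall>h\<in>U - Sep X Y. Z h = composition X Y h"
    using strong_elimination[of X Y e] assms by (auto simp: in_Sep_iff)
  have "Z h = (if X h \<noteq> Zero then X h else Y h)" if "X h = Zero \<or> Y h \<noteq> - X h" for h
    using Z(3) that covector_off_ground[OF Z(1), of h] covector_off_ground[OF assms(1), of h]
      covector_off_ground[OF assms(2), of h]
    by (cases "h \<in> U") (auto simp: in_Sep_iff composition_def)
  with Z show thesis using that by blast
qed

text \<open>With \<open>e\<close> as the element at infinity, \<open>Z\<close> plays the role of the
  difference of two points of an affine space: it is a direction from \<open>Y\<close> to
  \<open>X\<close>.\<close>

lemma elimination_uminus:
  assumes "X \<in> L" "Y \<in> L" "X e \<noteq> Zero" "Y e = X e"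
  obtains Z where "Z \<in> L" "Z e = Zero"
    "\<And>h. X h = Zero \<or> Y h \<noteq> X h \<Longrightarrow> Z h = (if X h \<noteq> Zero then X h else - Y h)"
proof -
  have "(- Y) e = - X e" using assms by simp
  then obtain Z where Z: "Z \<in> L" "Z e = Zero"
    "\<And>h. X h = Zero \<or> (- Y) h \<noteq> - X h \<Longrightarrow> Z h = (if X h \<noteq> Zero then X h else (- Y) h)"
    using elimination[OF assms(1) symmetric[OF assms(2)] assms(3)] by blast
  show thesis
    by (rule that[OF Z(1,2)]) (use Z(3) in simp)
qed

text \<open>The contracted element stays in the ground set as a loop, so contractions can be
  iterated over the same \<open>U\<close>.\<close>

lemma contraction: "oriented_matroid U {X \<in> L. X h = Zero}"
proof
  show "finite U" by (rule finite_ground)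
  show "{X \<in> L. X h = Zero} \<subseteq> sign_vectors U" using covectors by auto
next
  fix X Y assume "X \<in> {X \<in> L. X h = Zero}" "Y \<in> {X \<in> L. X h = Zero}"
  then show "composition X Y \<in> {X \<in> L. X h = Zero}"
    using comp_closed by (auto simp: composition_def)
next
  fix X Y e assume A: "X \<in> {X \<in> L. X h = Zero}" "Y \<in> {X \<in> L. X h = Zero}" "e \<in> Sep X Y"
  then obtain Z where "Z \<in> L" "Z e = Zero"
    "\<And>h. X h = Zero \<or> Y h \<noteq> - X h \<Longrightarrow> Z h = (if X h \<noteq> Zero then X h else Y h)"
    using elimination[of X Y e] by (auto simp: in_Sep_iff)
  then show "\<exists>Z\<in>{X \<in> L. X h = Zero}. Z e = Zero \<and> (\<forall>h\<in>U - Sep X Y. Z h = composition X Y h)"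
    using A by (intro bexI[of _ Z]) (auto simp: in_Sep_iff composition_def)
next
  fix X assume "X \<in> {X \<in> L. X h = Zero}"
  then show "- X \<in> {X \<in> L. X h = Zero}" using symmetric by auto
qed

lemma restriction:
  assumes "finite G"
  shows "oriented_matroid G (restr G ` L)"
proof
  show "finite G" by fact
  show "restr G ` L \<subseteq> sign_vectors G"
    by (auto simp: sign_vectors_def support_def restr_def split: if_splits)
next
  fix X Y assume "X \<in> restr G ` L" "Y \<in> restr G ` L"
  then obtain X' Y' where "X' \<in> L" "Y' \<in> L" and XY: "X = restr G X'" "Y = restr G Y'" by auto
  then have "composition X' Y' \<in> L" using comp_closed by auto
  moreover have "composition X Y = restr G (composition X' Y')"
    by (auto simp: XY restr_def composition_def)
  ultimately show "composition X Y \<in> restr G ` L" by auto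
next
  fix X Y e assume A: "X \<in> restr G ` L" "Y \<in> restr G ` L" "e \<in> Sep X Y"
  then obtain X' Y' where L: "X' \<in> L" "Y' \<in> L" and XY: "X = restr G X'" "Y = restr G Y'" by auto
  have e: "e \<in> G" "X' e \<noteq> Zero" "Y' e = - X' e"
    using A(3) by (auto simp: XY in_Sep_iff restr_def split: if_splits)
  obtain Z where "Z \<in> L" "Z e = Zero"
    "\<And>h. X' h = Zero \<or> Y' h \<noteq> - X' h \<Longrightarrow> Z h = (if X' h \<noteq> Zero then X' h else Y' h)"
    using elimination[OF L e(2,3)] by blast
  then show "\<exists>Z\<in>restr G ` L. Z e = Zero \<and> (\<forall>h\<in>G - Sep X Y. Z h = composition X Y h)"
    by (intro bexI[of _ "restr G Z"]) (auto simp: XY in_Sep_iff composition_def restr_def)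
next
  fix X assume "X \<in> restr G ` L"
  then obtain X' where "X' \<in> L" and X: "X = restr G X'" by auto
  then have "- X' \<in> L" using symmetric by auto
  moreover have "- X = restr G (- X')" by (auto simp: X restr_def)
  ultimately show "- X \<in> restr G ` L" by auto
qed

end

text \<open>\<open>Y\<close> is a direction at infinity. A small move from the point
  \<open>p\<close> along \<open>Y\<close> changes the objective \<open>e\<close> in direction \<rho>
  and can only violate constraints that are tight at \<open>p\<close>.\<close>

definition improves :: "('a \<Rightarrow> sign) \<Rightarrow> 'a \<Rightarrow> 'a \<Rightarrow> sign \<Rightarrow> ('a \<Rightarrow> sign) \<Rightarrow> ('a \<Rightarrow> sign) \<Rightarrow> bool" where
  "improves s f e \<rho> p Y \<longleftrightarrow>
    Y f = Zero \<and> Y e = \<rho> \<and> (\<forall>h. s h \<noteq> Zero \<and> p h = Zero \<longrightarrow> Y h \<noteq> - s h)"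

text \<open>
  Oriented matroid programming: in the affine space \<open>f = \<tau>\<close> the objective \<open>e\<close> is maximised in
  direction \<open>\<rho>\<close> over the polyhedron cut out by \<open>s\<close>. Dropping a constraint \<open>h\<close> gives an optimum
  \<open>p\<close>; if \<open>p\<close> violates \<open>h\<close>, an optimum \<open>p'\<close> on the hyperplane \<open>h = 0\<close> is optimal altogether, as an
  improving direction of \<open>p'\<close> would combine with the direction from \<open>p'\<close> to \<open>p\<close> to
  improve either \<open>p'\<close> inside \<open>h = 0\<close> or \<open>p\<close>.
\<close>

lemma optimum_exists:
  assumes "oriented_matroid U L" "finite (support s)" "s e = Zero" "\<tau> \<noteq> Zero" "\<rho> \<noteq> Zero"
    and "\<exists>X\<in>L. agrees s X \<and> X f = \<tau>"
    and "\<not> (\<exists>Y\<in>L. Y f = Zero \<and> Y e = \<rho> \<and> agrees s Y)"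
  shows "\<exists>p\<in>L. agrees s p \<and> p f = \<tau> \<and> \<not> (\<exists>Y\<in>L. improves s f e \<rho> p Y)"
  using assms
proof (induction "card (support s)" arbitrary: s L)
  case 0
  then have "s h = Zero" for h by (auto simp: support_def)
  with 0 show ?case by (auto simp: agrees_def improves_def)
next
  case (Suc n)
  interpret oriented_matroid U L by fact
  note \<tau> = \<open>\<tau> \<noteq> Zero\<close> and \<rho> = \<open>\<rho> \<noteq> Zero\<close>
  obtain h where h: "s h \<noteq> Zero" using Suc.hyps(2) by (force simp: support_def)
  define s' where "s' = s(h := Zero)"
  have "support s' = support s - {h}" by (auto simp: s'_def support_def)
  then have card: "n = card (support s')" "finite (support s')" "s' e = Zero"
    using Suc.hyps(2) Suc.prems h by (auto simp: support_def s'_def)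
  have agr: "agrees s X \<longleftrightarrow> agrees s' X \<and> X h \<noteq> - s h" for X
    using h by (auto simp: agrees_def s'_def)
  have imp: "improves s f e \<rho> p Y \<longleftrightarrow> improves s' f e \<rho> p Y \<and> (p h = Zero \<longrightarrow> Y h \<noteq> - s h)" for p Y
    using h by (auto simp: improves_def s'_def)
  obtain X where X: "X \<in> L" "agrees s X" "X f = \<tau>" using Suc.prems by auto
  let ?L' = "{X \<in> L. X h = Zero}"
  \<comment> \<open>The way from the feasible \<open>X\<close> towards \<open>q\<close>, a point or
    a direction that violates only \<open>h\<close>, crosses the hyperplane \<open>h = 0\<close> and
    keeps the other constraints.\<close>
  have contracted: "\<exists>p\<in>?L'. agrees s' p \<and> p f = \<tau> \<and> \<not> (\<exists>Y\<in>?L'. improves s' f e \<rho> p Y)"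
    if q: "q \<in> L" "agrees s' q" "q h = - s h" "q f = \<tau> \<or> q f = Zero" for q
  proof (rule Suc.hyps(1)[OF card(1) contraction card(2,3) \<tau> \<rho>])
    show "\<not> (\<exists>Y\<in>?L'. Y f = Zero \<and> Y e = \<rho> \<and> agrees s' Y)"
      using Suc.prems(7) h by (auto simp: agr)
    show "\<exists>X\<in>?L'. agrees s' X \<and> X f = \<tau>"
    proof (cases "X h = Zero")
      case True
      with X show ?thesis by (auto simp: agr)
    next
      case False
      then have "X h = s h" using X(2) sign_trichotomy[OF h, of "X h"] by (auto simp: agr)
      then obtain Z where Z: "Z \<in> L" "Z h = Zero"
        "\<And>w. X w = Zero \<or> q w \<noteq> - X w \<Longrightarrow> Z w = (if X w \<noteq> Zero then X w else q w)"
        using elimination[OF X(1) q(1), of h] q(3) h by auto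
      have "Z f = \<tau>" using Z(3)[of f] X(3) q(4) \<tau> by auto
      moreover have "Z w \<noteq> - s' w" if "s' w \<noteq> Zero" for w
      proof -
        have "X w \<noteq> - s' w" "q w \<noteq> - s' w" using X(2)[unfolded agr] q(2) that by (auto simp: agrees_def)
        then show ?thesis
          using Z(3)[of w] sign_trichotomy[OF that, of "X w"] sign_trichotomy[OF that, of "q w"] that
          by (auto split: if_splits)
      qed
      ultimately show ?thesis using Z by (auto simp: agrees_def)
    qed
  qed
  \<comment> \<open>An improving \<open>Y\<close> that leaves \<open>h = 0\<close> to the feasible
    side is balanced by a direction \<open>Z\<close> that leaves it to the other side without
    spoiling the objective.\<close>
  have eliminate_h: "\<exists>Q\<in>?L'. improves s' f e \<rho> p' Q"
    if Y: "Y \<in> L" "improves s' f e \<rho> p' Y" "Y h = s h"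
      and Z: "Z \<in> L" "Z f = Zero" "Z h = - s h" "Z e \<noteq> - \<rho>"
        "\<And>w. s' w \<noteq> Zero \<Longrightarrow> p' w = Zero \<Longrightarrow> Z w \<noteq> - s' w" for Y Z p'
  proof -
    obtain Q where Q: "Q \<in> L" "Q h = Zero"
      "\<And>w. Y w = Zero \<or> Z w \<noteq> - Y w \<Longrightarrow> Q w = (if Y w \<noteq> Zero then Y w else Z w)"
      using elimination[OF Y(1) Z(1), of h] Y(3) Z(3) h by auto
    have "Q f = Zero" "Q e = \<rho>"
      using Q(3)[of f] Q(3)[of e] Y(2) Z \<rho> by (auto simp: improves_def)
    moreover have "Q w \<noteq> - s' w" if "s' w \<noteq> Zero" "p' w = Zero" for w
    proof -
      have "Y w \<noteq> - s' w" "Z w \<noteq> - s' w" using Y(2) Z(5) that by (auto simp: improves_def)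
      then show ?thesis
        using Q(3)[of w] sign_trichotomy[OF that(1), of "Y w"] sign_trichotomy[OF that(1), of "Z w"] that
        by (auto split: if_splits)
    qed
    ultimately show ?thesis using Q by (auto simp: improves_def)
  qed
  show ?case
  \<comment> \<open>If dropping \<open>h\<close> makes the objective unbounded along some
    \<open>q\<close>, then \<open>q\<close> violates \<open>h\<close>, and balancing by
    \<open>q\<close> shows that an optimum on \<open>h = 0\<close> is optimal altogether.\<close>
  proof (cases "\<exists>Y\<in>L. Y f = Zero \<and> Y e = \<rho> \<and> agrees s' Y")
    case True
    then obtain q where q: "q \<in> L" "q f = Zero" "q e = \<rho>" "agrees s' q" by blast
    then have qh: "q h = - s h" using Suc.prems(7) agr by blast
    obtain p where p: "p \<in> L" "p h = Zero" "agrees s' p" "p f = \<tau>"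
        "\<not> (\<exists>Y\<in>?L'. improves s' f e \<rho> p Y)"
      using contracted[OF q(1,4) qh] q by blast
    have "\<not> improves s f e \<rho> p Y" if "Y \<in> L" for Y
    proof
      assume I: "improves s f e \<rho> p Y"
      then have "improves s' f e \<rho> p Y" "Y h \<noteq> - s h" using p by (auto simp: imp)
      moreover from this have "Y h = s h"
        using p(5) that sign_trichotomy[OF h, of "Y h"] by auto
      ultimately show False
        using eliminate_h[OF that, of p q] q qh p(5) \<rho> unfolding agrees_def by auto
    qed
    then show ?thesis using p h by (auto simp: agr)
  next
    case False
    then obtain p where p: "p \<in> L" "agrees s' p" "p f = \<tau>" "\<not> (\<exists>Y\<in>L. improves s' f e \<rho> p Y)"
      using Suc.hyps(1)[OF card(1) Suc.prems(1) card(2,3) \<tau> \<rho>] X agr by blast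
    show ?thesis
    proof (cases "p h = - s h")
      case False
      then show ?thesis using p by (auto simp: agr imp)
    next
      case ph: True
      obtain p' where p': "p' \<in> L" "p' h = Zero" "agrees s' p'" "p' f = \<tau>"
        "\<not> (\<exists>Y\<in>?L'. improves s' f e \<rho> p' Y)"
        using contracted[OF p(1,2) ph] p by blast
      obtain Z where Z: "Z \<in> L" "Z f = Zero"
        "\<And>w. p w = Zero \<or> p' w \<noteq> p w \<Longrightarrow> Z w = (if p w \<noteq> Zero then p w else - p' w)"
        using elimination_uminus[OF p(1) p'(1), of f] p p' \<tau> by auto
      have Zh: "Z h = - s h" using Z(3)[of h] ph p'(2) h by auto
      have "Z e = - \<rho>" if Y: "Y \<in> L" "improves s f e \<rho> p' Y" for Y
      proof (rule ccontr)
        assume Ze: "Z e \<noteq> - \<rho>"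
        from Y have I: "improves s' f e \<rho> p' Y" "Y h \<noteq> - s h" using p' by (auto simp: imp)
        then have "Y h = s h"
          using p'(5) Y sign_trichotomy[OF h, of "Y h"] by auto
        moreover have "Z w \<noteq> - s' w" if "s' w \<noteq> Zero" "p' w = Zero" for w
          using Z(3)[of w] p(2) that by (cases "p w = Zero") (auto simp: agrees_def)
        ultimately show False using eliminate_h[OF Y(1) I(1) _ Z(1,2) Zh Ze] p' by blast
      qed
      moreover have "Z e \<noteq> - \<rho>"
      proof
        assume "Z e = - \<rho>"
        moreover have "- Z w \<noteq> - s' w" if "s' w \<noteq> Zero" "p w = Zero" for w
          using Z(3)[of w] p'(3) that by (auto simp: agrees_def)
        ultimately have "improves s' f e \<rho> p (- Z)" using Z(2) by (auto simp: improves_def)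
        then show False using p(4) symmetric[OF Z(1)] by blast
      qed
      ultimately have "\<not> (\<exists>Y\<in>L. improves s f e \<rho> p' Y)" by blast
      then show ?thesis using p' h by (auto simp: agr)
    qed
  qed
qed

section \<open>Lexicographic extensions\<close>

definition leads :: "'a set \<Rightarrow> ('a \<Rightarrow> nat) \<Rightarrow> ('a \<Rightarrow> sign) \<Rightarrow> sign \<Rightarrow> bool" where
  "leads B ord X t \<longleftrightarrow> t \<noteq> Zero \<and> (\<exists>i\<in>B. X i = t \<and> (\<forall>j\<in>B. ord j < ord i \<longrightarrow> X j = Zero))"

definition has_face ::
  "'a set \<Rightarrow> ('a \<Rightarrow> nat) \<Rightarrow> ('a \<Rightarrow> sign) set \<Rightarrow> ('a \<Rightarrow> sign) \<Rightarrow> sign \<Rightarrow> bool" where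
  "has_face B ord L X t \<longleftrightarrow> (\<exists>Y\<in>L. Y \<le> X \<and> leads B ord Y t)"

text \<open>
  The extension by the element \<open>f = e\<^sub>1 + \<epsilon> e\<^sub>2 + \<epsilon>\<^sup>2 e\<^sub>3 + \<dots>\<close>, where \<open>e\<^sub>1, e\<^sub>2, \<dots>\<close> enumerate \<open>B\<close> in
  increasing order: on a covector \<open>X\<close> it attains the leading signs of the faces of \<open>X\<close>.
\<close>

definition lext ::
  "'a set \<Rightarrow> ('a \<Rightarrow> nat) \<Rightarrow> ('a \<Rightarrow> sign) set \<Rightarrow> 'a \<Rightarrow> ('a \<Rightarrow> sign) set" where
  "lext B ord L f = {X. X(f := Zero) \<in> L \<and>
    (if X f = Zero then X = zero_vector \<or> (has_face B ord L X Plus \<and> has_face B ord L X Minus)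
     else has_face B ord L (X(f := Zero)) (X f))}"

text \<open>General position in matroid terms: an element \<open>e\<close> outside the closure of
  \<open>A\<close> can enter the closure of \<open>A\<close> together with \<open>f\<close> only if
  that larger set spans everything.\<close>

definition generic :: "'a set \<Rightarrow> ('a \<Rightarrow> sign) set \<Rightarrow> 'a \<Rightarrow> bool" where
  "generic V L f \<longleftrightarrow> (\<forall>A e Y p. A \<subseteq> V \<and> e \<in> V \<and> Y \<in> L \<and> p \<in> L \<and> Y f = Zero \<and> Y \<noteq> zero_vector \<and>
    (\<forall>a\<in>A. Y a = Zero \<and> p a = Zero) \<and> p e \<noteq> Zero \<longrightarrow>
    (\<exists>Y'\<in>L. Y' f = Zero \<and> (\<forall>a\<in>A. Y' a = Zero) \<and> Y' e \<noteq> Zero))"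

lemma has_face_mono: "has_face B ord L X t \<Longrightarrow> L \<subseteq> L' \<Longrightarrow> X \<le> X' \<Longrightarrow> has_face B ord L' X' t"
  unfolding has_face_def by (meson order_trans subsetD)

lemma has_face_nonzero: "has_face B ord L X t \<Longrightarrow> \<exists>e\<in>B. X e \<noteq> Zero"
  unfolding has_face_def leads_def le_sign_vector_iff by metis

lemma leads_uminus: "leads B ord X t \<Longrightarrow> leads B ord (- X) (- t)"
  by (auto simp: leads_def)

lemma leads_unique:
  assumes "inj_on ord B" "leads B ord X t" "leads B ord X u"
  shows "t = u"
proof -
  obtain i j where "i \<in> B" "X i = t" "\<forall>k\<in>B. ord k < ord i \<longrightarrow> X k = Zero"
    "j \<in> B" "X j = u" "\<forall>k\<in>B. ord k < ord j \<longrightarrow> X k = Zero" "t \<noteq> Zero" "u \<noteq> Zero"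
    using assms(2,3) by (auto simp: leads_def)
  then show ?thesis using assms(1) by (metis inj_onD linorder_neqE_nat)
qed

text \<open>\<open>B\<close> may be smaller than the ground set: the second extension has
  \<open>f\<close> in its ground set but is still ordered along \<open>U\<close>. Nonzero covectors
  must be visible on \<open>B\<close> in order to have a leading sign.\<close>

locale lexicographic = oriented_matroid V L for V :: "'a set" and L +
  fixes B :: "'a set" and ord :: "'a \<Rightarrow> nat"
  assumes B_subset: "B \<subseteq> V" and inj_ord: "inj_on ord B"
    and nonzero_on_B: "X \<in> L \<Longrightarrow> X \<noteq> zero_vector \<Longrightarrow> \<exists>e\<in>B. X e \<noteq> Zero"
begin

lemma leads_exists:
  assumes "X \<in> L" "X \<noteq> zero_vector"
  obtains t where "leads B ord X t"
proof -
  obtain e where "e \<in> B \<and> X e \<noteq> Zero" using nonzero_on_B[OF assms] by blast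
  from ex_has_least_nat[of "\<lambda>e. e \<in> B \<and> X e \<noteq> Zero", OF this, of ord]
  obtain i where i: "i \<in> B" "X i \<noteq> Zero" and "\<forall>j. j \<in> B \<and> X j \<noteq> Zero \<longrightarrow> ord i \<le> ord j" by auto
  then have "\<forall>j\<in>B. ord j < ord i \<longrightarrow> X j = Zero" by force
  with i have "leads B ord X (X i)" by (auto simp: leads_def)
  then show thesis by (rule that)
qed

lemma has_face_self:
  assumes "X \<in> L" "X \<noteq> zero_vector"
  obtains t where "t \<noteq> Zero" "has_face B ord L X t"
  using leads_exists[OF assms] assms unfolding has_face_def leads_def by (metis order_refl)

lemma has_face_uminus: "has_face B ord L X t \<Longrightarrow> has_face B ord L (- X) (- t)"
  unfolding has_face_def
  by (metis (no_types, lifting) leads_uminus symmetric le_sign_vector_iff sign_uminus_eq_Zero uminus_apply)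

text \<open>This is elimination of the new element between \<open>X\<close> and \<open>X'\<close>.
  Without separation, their composition contains both faces. Otherwise a separating element is
  eliminated; the outcome \<open>Z\<close> is zero or has a face with some leading sign, and it
  replaces \<open>X\<close> or \<open>X'\<close> accordingly, which leaves fewer separating
  elements.\<close>

lemma both_faces_elimination:
  assumes "X \<in> L" "X' \<in> L" "has_face B ord L X t" "has_face B ord L X' (- t)" "t \<noteq> Zero"
  shows "\<exists>Q\<in>L. (Q = zero_vector \<or> (has_face B ord L Q Plus \<and> has_face B ord L Q Minus)) \<and>
    (\<forall>h. X h = Zero \<or> X' h \<noteq> - X h \<longrightarrow> Q h = (if X h \<noteq> Zero then X h else X' h))"
  using assms
proof (induction "card (Sep X X')" arbitrary: X X' t rule: less_induct)
  case less
  have both: "has_face B ord L Q Plus \<and> has_face B ord L Q Minus"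
    if "has_face B ord L Q t" "has_face B ord L Q (- t)" for Q
    using that less.prems(5) by (cases t) auto
  show ?case
  proof (cases "Sep X X' = {}")
    case True
    let ?Q = "composition X X'"
    have "X \<le> ?Q" "X' \<le> ?Q"
      using True sign_trichotomy by (auto simp: le_sign_vector_iff composition_def in_Sep_iff set_eq_iff) metis
    then have "has_face B ord L ?Q t" "has_face B ord L ?Q (- t)"
      using less.prems has_face_mono by blast+
    then show ?thesis using both comp_closed less.prems
      by (intro bexI[of _ ?Q]) (auto simp: composition_def)
  next
    case False
    then obtain e where e: "X e \<noteq> Zero" "X' e = - X e" by (auto simp: in_Sep_iff)
    then obtain Z where Z: "Z \<in> L" "Z e = Zero"
      "\<And>h. X h = Zero \<or> X' h \<noteq> - X h \<Longrightarrow> Z h = (if X h \<noteq> Zero then X h else X' h)"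
      using elimination[of X X' e] less.prems by metis
    have fin: "finite (Sep X X')"
      by (rule finite_subset[OF _ finite_ground])
        (use less.prems(1) covector_off_ground in_Sep_iff in fast)
    have eS: "e \<in> Sep X X'" using e by (auto simp: in_Sep_iff)
    consider "Z = zero_vector" | "has_face B ord L Z t" | "has_face B ord L Z (- t)"
      using has_face_self[OF Z(1)] sign_trichotomy[OF less.prems(5)] by metis
    then show ?thesis
    proof cases
      case 1
      with Z show ?thesis by auto
    next
      case 2
      have "Sep Z X' \<subseteq> Sep X X' - {e}"
      proof
        fix h assume "h \<in> Sep Z X'"
        then show "h \<in> Sep X X' - {e}" using Z(2) Z(3)[of h]
          by (cases "X h = Zero \<or> X' h \<noteq> - X h") (auto simp: in_Sep_iff split: if_splits)
      qed
      then have "card (Sep Z X') < card (Sep X X')" using fin eS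
        by (intro psubset_card_mono) auto
      from less.hyps[OF this Z(1) less.prems(2) 2 less.prems(4,5)]
      obtain Q where Q: "Q \<in> L" "Q = zero_vector \<or> (has_face B ord L Q Plus \<and> has_face B ord L Q Minus)"
        "\<And>h. Z h = Zero \<or> X' h \<noteq> - Z h \<Longrightarrow> Q h = (if Z h \<noteq> Zero then Z h else X' h)" by blast
      have "Q h = (if X h \<noteq> Zero then X h else X' h)" if "X h = Zero \<or> X' h \<noteq> - X h" for h
        using Q(3)[of h] Z(3)[OF that] that by (auto split: if_splits)
      with Q show ?thesis by blast
    next
      case 3
      have "Sep X Z \<subseteq> Sep X X' - {e}"
      proof
        fix h assume "h \<in> Sep X Z"
        then show "h \<in> Sep X X' - {e}" using Z(2) Z(3)[of h]
          by (cases "X h = Zero \<or> X' h \<noteq> - X h") (auto simp: in_Sep_iff split: if_splits)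
      qed
      then have "card (Sep X Z) < card (Sep X X')" using fin eS
        by (intro psubset_card_mono) auto
      from less.hyps[OF this less.prems(1) Z(1) less.prems(3) 3 less.prems(5)]
      obtain Q where Q: "Q \<in> L" "Q = zero_vector \<or> (has_face B ord L Q Plus \<and> has_face B ord L Q Minus)"
        "\<And>h. X h = Zero \<or> Z h \<noteq> - X h \<Longrightarrow> Q h = (if X h \<noteq> Zero then X h else Z h)" by blast
      have "Q h = (if X h \<noteq> Zero then X h else X' h)" if "X h = Zero \<or> X' h \<noteq> - X h" for h
        using Q(3)[of h] Z(3)[OF that] that by (auto split: if_splits)
      with Q show ?thesis by blast
    qed
  qed
qed

text \<open>Elimination of an old element that keeps the sign \<open>t\<close> at the new one. A
  face \<open>P\<close> with leading sign \<open>t\<close> is obtained from the given faces, by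
  elimination unless one of them already vanishes at \<open>e\<close>. As \<open>P\<close> conforms
  to \<open>X\<close> and \<open>X'\<close> wherever these do not conflict, it can be put in front
  of \<open>Z\<close>.\<close>

lemma face_preserving_elimination:
  assumes "X \<in> L" "X' \<in> L" "has_face B ord L X t" "has_face B ord L X' t"
    and "X e \<noteq> Zero" "X' e = - X e"
  obtains Z where "Z \<in> L" "Z e = Zero" "has_face B ord L Z t"
    "\<And>h. X h = Zero \<or> X' h \<noteq> - X h \<Longrightarrow> Z h = (if X h \<noteq> Zero then X h else X' h)"
proof -
  obtain Z where Z: "Z \<in> L" "Z e = Zero"
    "\<And>h. X h = Zero \<or> X' h \<noteq> - X h \<Longrightarrow> Z h = (if X h \<noteq> Zero then X h else X' h)"
    using elimination[OF assms(1,2,5,6)] by blast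
  obtain Y Y' where Y: "Y \<in> L" "\<And>h. Y h \<noteq> Zero \<Longrightarrow> X h = Y h" "leads B ord Y t"
    and Y': "Y' \<in> L" "\<And>h. Y' h \<noteq> Zero \<Longrightarrow> X' h = Y' h" "leads B ord Y' t"
    using assms(3,4) by (auto simp: has_face_def le_sign_vector_iff)
  have "\<exists>P\<in>L. P e = Zero \<and> leads B ord P t \<and>
    (\<forall>h. (X h = Zero \<or> X' h \<noteq> - X h) \<longrightarrow> P h \<noteq> Zero \<longrightarrow> P h = (if X h \<noteq> Zero then X h else X' h))"
  proof (cases "Y e = Zero \<or> Y' e = Zero")
    case True
    then show ?thesis
    proof
      assume "Y e = Zero"
      then show ?thesis using Y by (intro bexI[of _ Y]) auto
    next
      assume "Y' e = Zero"
      moreover have "Y' h = (if X h \<noteq> Zero then X h else X' h)"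
        if "X h = Zero \<or> X' h \<noteq> - X h" "Y' h \<noteq> Zero" for h
        using that Y'(2)[of h] sign_trichotomy[of "X h" "Y' h"] by auto
      ultimately show ?thesis using Y'(1,3) by blast
    qed
  next
    case False
    then have "Y' e = - Y e" using Y(2)[of e] Y'(2)[of e] assms(6) by auto
    then obtain P where P: "P \<in> L" "P e = Zero"
      "\<And>h. Y h = Zero \<or> Y' h \<noteq> - Y h \<Longrightarrow> P h = (if Y h \<noteq> Zero then Y h else Y' h)"
      using elimination[OF Y(1) Y'(1)] False by metis
    obtain i where i: "t \<noteq> Zero" "i \<in> B" "Y i = t" "\<forall>j\<in>B. ord j < ord i \<longrightarrow> Y j = Zero"
      using Y(3) by (auto simp: leads_def)
    obtain j where j: "j \<in> B" "Y' j = t" "\<forall>k\<in>B. ord k < ord j \<longrightarrow> Y' k = Zero"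
      using Y'(3) by (auto simp: leads_def)
    \<comment> \<open>The earlier of the two leading positions: up to there \<open>Y\<close> and
      \<open>Y'\<close> never disagree, so \<open>P\<close> is their composition.\<close>
    define k where "k = (if ord i \<le> ord j then i else j)"
    have k: "k \<in> B" using i j by (auto simp: k_def)
    moreover have "P k = t"
    proof (cases "ord i < ord j \<or> ord j < ord i")
      case True
      then show ?thesis using i j P(3)[of k] by (auto simp: k_def)
    next
      case False
      then have "i = j" using i j inj_ord by (metis inj_onD linorder_neqE_nat)
      then show ?thesis using i j P(3)[of k] by (auto simp: k_def)
    qed
    moreover have "P l = Zero" if "l \<in> B" "ord l < ord k" for l
      using P(3)[of l] i j that by (auto simp: k_def split: if_splits)
    ultimately have "leads B ord P t" using i by (auto simp: leads_def)
    moreover have "P h = (if X h \<noteq> Zero then X h else X' h)"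
      if "X h = Zero \<or> X' h \<noteq> - X h" "P h \<noteq> Zero" for h
    proof (cases "Y h = Zero")
      case True
      then show ?thesis
        using that P(3)[of h] Y'(2)[of h] sign_trichotomy[of "X h" "X' h"] by auto
    next
      case False
      then have "Y' h \<noteq> - Y h" using that(1) Y(2)[of h] Y'(2)[of h] by auto
      then show ?thesis using False P(3)[of h] Y(2)[of h] by auto
    qed
    ultimately show ?thesis using P by blast
  qed
  then obtain P where P: "P \<in> L" "P e = Zero" "leads B ord P t"
    "\<And>h. X h = Zero \<or> X' h \<noteq> - X h \<Longrightarrow> P h \<noteq> Zero \<Longrightarrow> P h = (if X h \<noteq> Zero then X h else X' h)"
    by blast
  show thesis
  proof (rule that[of "composition P Z"])
    show "composition P Z \<in> L" using P Z comp_closed by blast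
    show "composition P Z e = Zero" using P Z by (auto simp: composition_def)
    have "P \<le> composition P Z" by (auto simp: le_sign_vector_iff composition_def)
    then show "has_face B ord L (composition P Z) t" using P by (auto simp: has_face_def)
    show "composition P Z h = (if X h \<noteq> Zero then X h else X' h)" if "X h = Zero \<or> X' h \<noteq> - X h" for h
      using P(4)[OF that] Z(3)[OF that] by (auto simp: composition_def)
  qed
qed

section \<open>Extension by one new element\<close>

context
  fixes f assumes f_fresh: "f \<notin> V"
begin

lemma covector_fresh [simp]: "X \<in> L \<Longrightarrow> X f = Zero"
  using covector_off_ground f_fresh by blast

lemma covector_upd_fresh [simp]: "X \<in> L \<Longrightarrow> X(f := Zero) = X"
  by (simp add: fun_upd_idem)

lemma lext_upd: "X \<in> L \<Longrightarrow> t \<noteq> Zero \<Longrightarrow> has_face B ord L X t \<Longrightarrow> X(f := t) \<in> lext B ord L f"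
  by (auto simp: lext_def)

lemma lext_both:
  "X \<in> L \<Longrightarrow> has_face B ord L X Plus \<Longrightarrow> has_face B ord L X Minus \<Longrightarrow> X \<in> lext B ord L f"
  by (auto simp: lext_def)

lemma lext_deletion: "X \<in> lext B ord L f \<Longrightarrow> X(f := Zero) \<in> L"
  by (auto simp: lext_def)

lemma lext_lift:
  assumes "X \<in> L"
  obtains t where "X(f := t) \<in> lext B ord L f"
proof (cases "X = zero_vector")
  case True
  then have "X(f := Zero) \<in> lext B ord L f" using assms by (auto simp: lext_def)
  then show ?thesis by (rule that)
next
  case False
  then show ?thesis using has_face_self[OF assms] lext_upd[OF assms] that by metis
qed

lemma lext_has_face:
  assumes "X \<in> lext B ord L f" "X \<noteq> zero_vector" "t \<noteq> Zero" "X f \<noteq> - t"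
  shows "has_face B ord L (X(f := Zero)) t"
proof (cases "X f = Zero")
  case True
  then have "X(f := Zero) = X" by auto
  then show ?thesis using assms True by (cases t) (auto simp: lext_def)
next
  case False
  then have "X f = t" using assms sign_trichotomy by metis
  then show ?thesis using assms by (auto simp: lext_def)
qed

lemma oriented_matroid_lext: "oriented_matroid (insert f V) (lext B ord L f)"
proof
  show "finite (insert f V)" using finite_ground by simp
  show "lext B ord L f \<subseteq> sign_vectors (insert f V)"
  proof
    fix X assume "X \<in> lext B ord L f"
    then have "X(f := Zero) \<in> L" by (rule lext_deletion)
    then have "X h = Zero" if "h \<notin> insert f V" for h
      using covector_off_ground[of "X(f := Zero)" h] that by auto
    then show "X \<in> sign_vectors (insert f V)" by (auto simp: sign_vectors_def support_def)
  qed
next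
  fix X X' assume A: "X \<in> lext B ord L f" "X' \<in> lext B ord L f"
  let ?x = "X(f := Zero)" and ?x' = "X'(f := Zero)"
  have L: "?x \<in> L" "?x' \<in> L" using A lext_deletion by auto
  then have C: "composition ?x ?x' \<in> L" using comp_closed by auto
  have le: "?x \<le> composition ?x ?x'" by (auto simp: le_sign_vector_iff composition_def)
  have upd: "composition X X' = (composition ?x ?x')(f := composition X X' f)"
    by (auto simp: composition_def)
  consider "X = zero_vector" | "X \<noteq> zero_vector" "X f = Zero" | "X f \<noteq> Zero" by blast
  then show "composition X X' \<in> lext B ord L f"
  proof cases
    case 1
    then have "composition X X' = X'" by (auto simp: composition_def)
    then show ?thesis using A by simp
  next
    case 2
    then have F: "has_face B ord L (composition ?x ?x') Plus" "has_face B ord L (composition ?x ?x') Minus"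
      using lext_has_face[OF A(1)] has_face_mono[OF _ order_refl le] by auto
    show ?thesis
    proof (cases "X' f = Zero")
      case True
      then have "composition X X' = composition ?x ?x'" using 2 by (auto simp: composition_def)
      then show ?thesis using lext_both[OF C F] by simp
    next
      case False
      then show ?thesis using lext_upd[OF C, of "X' f"] F 2
        by (subst upd) (cases "X' f"; auto simp: composition_apply)
    qed
  next
    case 3
    then have "has_face B ord L (composition ?x ?x') (X f)"
      using lext_has_face[OF A(1), of "X f"] has_face_mono[OF _ order_refl le] by auto
    then show ?thesis using lext_upd[OF C, of "X f"] 3
      by (subst upd) (auto simp: composition_apply)
  qed
next
  fix X assume A: "X \<in> lext B ord L f"
  let ?x = "X(f := Zero)"
  have L: "- ?x \<in> L" using A lext_deletion symmetric by auto
  have upd: "- X = (- ?x)(f := - X f)" by auto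
  consider "X = zero_vector" | "X \<noteq> zero_vector" "X f = Zero" | "X f \<noteq> Zero" by blast
  then show "- X \<in> lext B ord L f"
  proof cases
    case 1
    then have "- X = X" by auto
    then show ?thesis using A by simp
  next
    case 2
    then have "has_face B ord L (- ?x) (- Plus)" "has_face B ord L (- ?x) (- Minus)"
      using has_face_uminus[OF lext_has_face[OF A(1), of Plus]]
        has_face_uminus[OF lext_has_face[OF A(1), of Minus]] by auto
    then have "- ?x \<in> lext B ord L f" using lext_both[OF L] by simp
    moreover have "?x = X" using 2 by auto
    ultimately show ?thesis by simp
  next
    case 3
    then have "has_face B ord L (- ?x) (- X f)"
      using lext_has_face[OF A(1), of "X f"] has_face_uminus by fastforce
    then show ?thesis using lext_upd[OF L, of "- X f"] 3 by (subst upd) auto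
  qed
next
  fix X X' e assume A: "X \<in> lext B ord L f" "X' \<in> lext B ord L f" "e \<in> Sep X X'"
  let ?x = "X(f := Zero)" and ?x' = "X'(f := Zero)"
  have L: "?x \<in> L" "?x' \<in> L" using A lext_deletion by auto
  have e: "X e \<noteq> Zero" "X' e = - X e" using A(3) by (auto simp: in_Sep_iff)
  have ne: "X \<noteq> zero_vector" "X' \<noteq> zero_vector" using e by auto
  define good where "good = (\<lambda>Z. \<forall>h. ?x h = Zero \<or> ?x' h \<noteq> - ?x h \<longrightarrow>
    Z h = (if ?x h \<noteq> Zero then ?x h else ?x' h))"
  have final: "\<exists>Z\<in>lext B ord L f. Z e = Zero \<and> (\<forall>h\<in>insert f V - Sep X X'. Z h = composition X X' h)"
    if Z: "Z(f := t) \<in> lext B ord L f" "good Z" "(Z(f := t)) e = Zero"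
      "f \<notin> Sep X X' \<Longrightarrow> t = composition X X' f" for Z t
  proof (intro bexI[OF _ Z(1)] conjI ballI)
    show "(Z(f := t)) e = Zero" by fact
    fix h assume "h \<in> insert f V - Sep X X'"
    then show "(Z(f := t)) h = composition X X' h"
      using Z(2)[unfolded good_def, rule_format, of h] Z(4) by (auto simp: in_Sep_iff composition_def)
  qed
  show "\<exists>Z\<in>lext B ord L f. Z e = Zero \<and> (\<forall>h\<in>insert f V - Sep X X'. Z h = composition X X' h)"
  proof (cases "e = f")
    case True
    have "has_face B ord L ?x (X f)" "has_face B ord L ?x' (- X f)"
      using lext_has_face[OF A(1) ne(1), of "X f"] lext_has_face[OF A(2) ne(2), of "- X f"] e True by auto
    then obtain Q where Q: "Q \<in> L"
      "Q = zero_vector \<or> (has_face B ord L Q Plus \<and> has_face B ord L Q Minus)" "good Q"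
      using both_faces_elimination[OF L] e True unfolding good_def by metis
    then have "Q \<in> lext B ord L f" by (auto simp: lext_def)
    then show ?thesis using final[of Q Zero] Q True A(3) by simp
  next
    case False
    then have e': "?x e \<noteq> Zero" "?x' e = - ?x e" using e by auto
    have preserve: "\<exists>Z\<in>L. Z e = Zero \<and> has_face B ord L Z t \<and> good Z"
      if "t \<noteq> Zero" "X f \<noteq> - t" "X' f \<noteq> - t" for t
      using face_preserving_elimination[OF L _ _ e', of t]
        lext_has_face[OF A(1) ne(1), of t] lext_has_face[OF A(2) ne(2), of t] that
      unfolding good_def by metis
    \<comment> \<open>The value wanted at \<open>f\<close> is arbitrary, a sign, or zero. A zero is
      the demanding case, as a nonzero covector then needs faces of both leading signs.\<close>
    consider "f \<in> Sep X X'" | "f \<notin> Sep X X'" "composition X X' f \<noteq> Zero"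
      | "X f = Zero" "X' f = Zero" "composition X X' f = Zero"
      unfolding composition_apply by metis
    then show ?thesis
    proof cases
      case 1
      obtain Z where Z: "Z \<in> L" "Z e = Zero" "good Z"
        using elimination[OF L e'] unfolding good_def by metis
      then obtain t where "Z(f := t) \<in> lext B ord L f" using lext_lift by blast
      then show ?thesis using final[of Z t] Z 1 False by auto
    next
      case 2
      let ?t = "composition X X' f"
      have "X f \<noteq> - ?t" "X' f \<noteq> - ?t"
        using 2 by (auto simp: composition_def in_Sep_iff split: if_splits)
      then obtain Z where Z: "Z \<in> L" "Z e = Zero" "has_face B ord L Z ?t" "good Z"
        using preserve[of ?t] 2 by blast
      then show ?thesis using final[of Z ?t] lext_upd[of Z ?t] 2 False by auto
    next
      case 3
      obtain Z where Z: "Z \<in> L" "Z e = Zero" "has_face B ord L Z Plus" "good Z"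
        using preserve[of Plus] 3 by auto
      obtain Z' where Z': "Z' \<in> L" "Z' e = Zero" "has_face B ord L Z' Minus" "good Z'"
        using preserve[of Minus] 3 by auto
      \<comment> \<open>Eliminating \<open>f\<close> between \<open>Z\<close> and \<open>Z'\<close>
        has to keep the zero at \<open>e\<close>, so it takes place in the contraction by
        \<open>e\<close>.\<close>
      let ?L = "{X \<in> L. X e = Zero}"
      interpret c: oriented_matroid V ?L by (rule contraction)
      interpret c: lexicographic V ?L B ord
        by unfold_locales (use B_subset inj_ord nonzero_on_B in auto)
      have face: "has_face B ord ?L Y t" if "has_face B ord L Y t" "Y e = Zero" for Y t
        using that unfolding has_face_def le_sign_vector_iff by force
      obtain Q where Q: "Q \<in> L" "Q e = Zero"
        "Q = zero_vector \<or> (has_face B ord ?L Q Plus \<and> has_face B ord ?L Q Minus)"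
        "\<And>h. Z h = Zero \<or> Z' h \<noteq> - Z h \<Longrightarrow> Q h = (if Z h \<noteq> Zero then Z h else Z' h)"
      proof -
        have "Z \<in> ?L" "Z' \<in> ?L" "has_face B ord ?L Z Plus" "has_face B ord ?L Z' (- Plus)"
          using Z Z' face by auto
        from c.both_faces_elimination[OF this] show thesis using that by blast
      qed
      have "Q = zero_vector \<or> (has_face B ord L Q Plus \<and> has_face B ord L Q Minus)"
        using Q(3) has_face_mono[of B ord ?L Q _ L Q] by auto
      then have "Q \<in> lext B ord L f" using Q(1) by (auto simp: lext_def)
      moreover have "good Q"
        unfolding good_def
      proof (intro allI impI)
        fix h assume "?x h = Zero \<or> ?x' h \<noteq> - ?x h"
        then have "Z h = (if ?x h \<noteq> Zero then ?x h else ?x' h)" "Z' h = (if ?x h \<noteq> Zero then ?x h else ?x' h)"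
          using Z(4) Z'(4) unfolding good_def by blast+
        then show "Q h = (if ?x h \<noteq> Zero then ?x h else ?x' h)" using Q(4)[of h] by auto
      qed
      ultimately show ?thesis using final[of Q Zero] Q(1,2) 3 by simp
    qed
  qed
qed

text \<open>Since \<open>Y\<close> vanishes at \<open>f\<close>, it has faces \<open>P\<close> and
  \<open>M\<close> with leading signs \<open>p f\<close> and \<open>- p f\<close>. Both
  \<open>M\<close> and \<open>- P\<close> can cancel \<open>p\<close> at \<open>f\<close>, and they
  cannot both oppose \<open>p\<close> at \<open>e\<close>, because \<open>P\<close> and
  \<open>M\<close> carry the signs of \<open>Y\<close>.\<close>

lemma generic_lext: "generic V (lext B ord L f) f"
  unfolding generic_def
proof (intro allI impI, elim conjE)
  interpret e: oriented_matroid "insert f V" "lext B ord L f" by (rule oriented_matroid_lext)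
  fix A e Y p
  assume A: "A \<subseteq> V" "e \<in> V" and Y: "Y \<in> lext B ord L f" "Y f = Zero" "Y \<noteq> zero_vector"
    and p: "p \<in> lext B ord L f" "p e \<noteq> Zero" and z: "\<forall>a\<in>A. Y a = Zero \<and> p a = Zero"
  show "\<exists>Y'\<in>lext B ord L f. Y' f = Zero \<and> (\<forall>a\<in>A. Y' a = Zero) \<and> Y' e \<noteq> Zero"
  proof (cases "p f = Zero")
    case True
    with p z show ?thesis by auto
  next
    case False
    let ?t = "p f"
    have upd: "Y(f := Zero) = Y" using Y by auto
    obtain P where P: "P \<in> L" "\<And>h. P h \<noteq> Zero \<Longrightarrow> Y h = P h" "leads B ord P ?t"
      using lext_has_face[OF Y(1,3), of ?t] False Y by (auto simp: upd has_face_def le_sign_vector_iff)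
    obtain M where M: "M \<in> L" "\<And>h. M h \<noteq> Zero \<Longrightarrow> Y h = M h" "leads B ord M (- ?t)"
      using lext_has_face[OF Y(1,3), of "- ?t"] False Y by (auto simp: upd has_face_def le_sign_vector_iff)
    have "\<exists>R\<in>L. leads B ord R (- ?t) \<and> R e \<noteq> - p e \<and> (\<forall>a\<in>A. R a = Zero)"
    proof (cases "M e = - p e")
      case False
      moreover have "\<forall>a\<in>A. M a = Zero" using M(2) z by force
      ultimately show ?thesis using M by blast
    next
      case True
      then have "(- P) e \<noteq> - p e" using P(2)[of e] M(2)[of e] p(2) by auto
      moreover have "\<forall>a\<in>A. (- P) a = Zero" using P(2) z by force
      ultimately show ?thesis using symmetric[OF P(1)] leads_uminus[OF P(3)] by blast
    qed
    then obtain R where R: "R \<in> L" "leads B ord R (- ?t)" "R e \<noteq> - p e" "\<forall>a\<in>A. R a = Zero" by blast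
    then have "R(f := - ?t) \<in> lext B ord L f"
      using lext_upd[OF R(1), of "- ?t"] False by (auto simp: has_face_def)
    then obtain Z where Z: "Z \<in> lext B ord L f" "Z f = Zero"
      "\<And>h. p h = Zero \<or> (R(f := - ?t)) h \<noteq> - p h \<Longrightarrow> Z h = (if p h \<noteq> Zero then p h else (R(f := - ?t)) h)"
      using e.elimination[OF p(1), of "R(f := - ?t)" f] False by auto
    have "e \<noteq> f" using A f_fresh by auto
    then have "Z e \<noteq> Zero" using Z(3)[of e] R(3) p(2) by auto
    moreover have "Z a = Zero" if "a \<in> A" for a
      using Z(3)[of a] R(4) z that A f_fresh by auto
    ultimately show ?thesis using Z by blast
  qed
qed

end

end

section \<open>Samples on one side of a generic element\<close>

text \<open>
  Decoding of a set \<open>W\<close> that encodes a sample all of whose nonzero limits have sign \<open>- \<tau>\<close> at \<open>f\<close>.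
\<close>

definition one_sided_scheme ::
  "'a set \<Rightarrow> ('a \<Rightarrow> sign) set \<Rightarrow> 'a \<Rightarrow> sign \<Rightarrow> ('a set \<Rightarrow> 'a \<Rightarrow> sign) \<Rightarrow> bool" where
  "one_sided_scheme U L f \<tau> \<beta> \<longleftrightarrow> (\<forall>s. support s \<subseteq> U \<and> (\<exists>X\<in>L. s \<le> X) \<and>
    (\<forall>X\<in>L. agrees s X \<and> X f \<noteq> - \<tau> \<longrightarrow> X = zero_vector) \<longrightarrow>
    (\<exists>W\<subseteq>support s. spans L W \<and> shatters L W \<and> \<beta> W \<in> L \<and> s \<le> \<beta> W))"

lemma le_composition_face:
  assumes "agrees s p" "\<And>h. s h \<noteq> Zero \<Longrightarrow> p h = Zero \<Longrightarrow> X h = s h"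
  shows "s \<le> composition p X"
  using assms unfolding agrees_def le_sign_vector_iff composition_def by (metis sign_trichotomy)

text \<open>
  The least element \<open>e\<close> of the support is put into \<open>W\<close>, and the face of the cone on which \<open>e\<close> is
  maximal (relative to \<open>f\<close>) is a single covector \<open>p\<close>. The remaining elements of \<open>W\<close> are found in the
  localisation at \<open>p\<close>, where \<open>e\<close> takes over the role of \<open>f\<close>. They determine \<open>p\<close>.
\<close>

lemma one_sided_scheme_exists:
  assumes "oriented_matroid (insert f U) L" "f \<notin> U" "finite U" "inj_on (ord :: 'a \<Rightarrow> nat) U"
    and "generic U L f" "\<tau> \<noteq> Zero"
  shows "\<exists>\<beta>. one_sided_scheme U L f \<tau> \<beta>"
  using assms
proof (induction "card U" arbitrary: U L f \<tau> rule: less_induct)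
  case less
  interpret oriented_matroid "insert f U" L by fact
  note \<tau> = less.prems(6) and generic = less.prems(5)
  define F where "F p = {h\<in>U. p h = Zero}" for p :: "'a \<Rightarrow> sign"
  \<comment> \<open>The directions at \<open>p\<close>: the section \<open>f = 0\<close>, seen only
    on the constraints through \<open>p\<close> and on the objective \<open>e\<close>.\<close>
  define LF where "LF p e = restr (insert e (F p)) ` {X \<in> L. X f = Zero}" for p :: "'a \<Rightarrow> sign" and e
  define \<beta>F where "\<beta>F p e = (SOME \<beta>. one_sided_scheme (F p) (LF p e) e (p e) \<beta>)" for p :: "'a \<Rightarrow> sign" and e
  define vertex where "vertex W' = (SOME p. p \<in> L \<and> p f = - \<tau> \<and> (\<forall>w\<in>W'. p w = Zero))" for W'
  define lift where "lift p e T = (SOME X. X \<in> L \<and> X f = Zero \<and> restr (insert e (F p)) X = T)" for p e T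
  define \<beta> where "\<beta> W = (if W = {} then zero_vector else
    let e = arg_min_on ord W; p = vertex (W - {e}) in
      composition p (lift p e (\<beta>F p e (W - {e}))))" for W
  have "\<exists>W\<subseteq>support s. spans L W \<and> shatters L W \<and> \<beta> W \<in> L \<and> s \<le> \<beta> W"
    if sU: "support s \<subseteq> U" and realizable: "\<exists>X\<in>L. s \<le> X"
      and bounded: "\<And>X. X \<in> L \<Longrightarrow> agrees s X \<Longrightarrow> X f \<noteq> - \<tau> \<Longrightarrow> X = zero_vector" for s
  proof (cases "support s = {}")
    case True
    then have s: "s = zero_vector" by (auto simp: support_def)
    \<comment> \<open>For the empty sample \<open>X\<close> and \<open>- X\<close> are both limits,
      and they cannot both have sign \<open>- \<tau>\<close> at \<open>f\<close>.\<close>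
    have L0: "X = zero_vector" if "X \<in> L" for X
    proof (rule ccontr)
      assume "X \<noteq> zero_vector"
      then have "X f = - \<tau>" using bounded[OF that] s by (auto simp: agrees_def)
      then have "(- X) f \<noteq> - \<tau>" using \<tau> by auto
      then have "- X = zero_vector"
        using bounded[OF symmetric[OF that]] s by (auto simp: agrees_def)
      then have "(- X) f = Zero" by simp
      with \<open>X f = - \<tau>\<close> \<tau> show False by simp
    qed
    have "spans L {}" unfolding spans_def using L0 by blast
    moreover have "zero_vector \<in> L" using realizable L0 by metis
    moreover have "\<beta> {} = zero_vector" by (simp add: \<beta>_def)
    ultimately show ?thesis
      by (intro exI[of _ "{}"]) (auto simp: shatters_def s)
  next
    case False
    have fin: "finite (support s)" using sU less.prems(3) finite_subset by blast
    define e where "e = arg_min_on ord (support s)"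
    have es: "e \<in> support s" using arg_min_if_finite(1)[OF fin False] by (simp add: e_def)
    then have eU: "e \<in> U" and se: "s e \<noteq> Zero" using sU by (auto simp: support_def)
    have ef: "e \<noteq> f" using eU less.prems(2) by auto
    obtain X0 where X0: "X0 \<in> L" "s \<le> X0" using realizable by blast
    then have X0s: "X0 h = s h" if "s h \<noteq> Zero" for h using that by (auto simp: le_sign_vector_iff)
    have X0f: "X0 f = - \<tau>" using bounded[OF X0(1) agrees_if_le[OF X0(2)]] X0s[OF se] se by metis
    \<comment> \<open>The constraint at \<open>e\<close> is dropped because \<open>e\<close> becomes
      the objective. That the optimum satisfies it strictly is shown afterwards.\<close>
    define s' where "s' = s(e := Zero)"
    have agr: "agrees s X \<longleftrightarrow> agrees s' X \<and> X e \<noteq> - s e" for X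
      using se by (auto simp: agrees_def s'_def)
    have "finite (support s')"
      by (rule finite_subset[OF _ fin]) (auto simp: s'_def support_def)
    moreover have "\<not> (\<exists>Y\<in>L. Y f = Zero \<and> Y e = s e \<and> agrees s' Y)"
      using bounded agr se \<tau> by force
    moreover have "\<exists>X\<in>L. agrees s' X \<and> X f = - \<tau>"
      using X0(1) agrees_if_le[OF X0(2)] X0f agr by blast
    ultimately obtain p where p: "p \<in> L" "agrees s' p" "p f = - \<tau>"
      and opt: "\<And>Y. Y \<in> L \<Longrightarrow> \<not> improves s' f e (s e) p Y"
      using optimum_exists[OF less.prems(1), of s' e "- \<tau>" "s e" f] \<tau> se by (auto simp: s'_def)
    \<comment> \<open>The direction from \<open>p\<close> to the realising covector
      \<open>X0\<close>. It would improve \<open>p\<close> if \<open>p e\<close> were not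
      \<open>s e\<close>, and later it realises the localised sample.\<close>
    obtain Z0 where Z0: "Z0 \<in> L" "Z0 f = Zero"
      "\<And>h. X0 h = Zero \<or> p h \<noteq> X0 h \<Longrightarrow> Z0 h = (if X0 h \<noteq> Zero then X0 h else - p h)"
      using elimination_uminus[OF X0(1) p(1), of f] X0f p(3) \<tau> by auto
    have pe: "p e = s e"
    proof (rule ccontr)
      assume "p e \<noteq> s e"
      then have "improves s' f e (s e) p Z0"
        using Z0(2) Z0(3)[of e] X0s[OF se] se Z0(3) X0s
        by (auto simp: improves_def s'_def split: if_splits)
      with opt Z0(1) show False by blast
    qed
    then have p_agrees: "agrees s p" using p(2) se by (auto simp: agr)
    have localised: "Y = zero_vector"
      if Y: "Y \<in> L" "Y f = Zero" "Y e \<noteq> - s e" "\<And>h. h \<in> F p \<Longrightarrow> s h \<noteq> Zero \<Longrightarrow> Y h \<noteq> - s h" for Y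
    proof (rule ccontr)
      assume nz: "Y \<noteq> zero_vector"
      have improvesI: "improves s' f e (s e) p Y'"
        if "Y' f = Zero" "Y' e = s e" "\<And>h. h \<in> F p \<Longrightarrow> s h \<noteq> Zero \<Longrightarrow> Y' h \<noteq> - s h" for Y'
        using that sU by (auto simp: improves_def s'_def F_def support_def)
      show False
      proof (cases "Y e = Zero")
        case False
        then have "Y e = s e" using Y(3) sign_trichotomy[OF se] by blast
        then show False using improvesI[of Y] Y opt by blast
      next
        case True
        \<comment> \<open>A direction with constant objective is perturbed: genericity gives
          \<open>Y'\<close> that changes \<open>e\<close> and vanishes on the constraints through
          \<open>p\<close> at which \<open>Y\<close> vanishes, so \<open>Y\<close> composed with
          \<open>Y'\<close> stays feasible and improves.\<close>
        define A where "A = {h\<in>F p. Y h = Zero}"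
        have "\<exists>Y'\<in>L. Y' f = Zero \<and> (\<forall>a\<in>A. Y' a = Zero) \<and> Y' e \<noteq> Zero"
          using generic[unfolded generic_def, rule_format, of A e Y p] eU Y p(1) nz pe se
          by (auto simp: A_def F_def)
        then obtain Y' where Y': "Y' \<in> L" "Y' f = Zero" "\<forall>a\<in>A. Y' a = Zero" "Y' e \<noteq> Zero" by blast
        have "\<exists>Y'\<in>L. Y' f = Zero \<and> (\<forall>a\<in>A. Y' a = Zero) \<and> Y' e = s e"
        proof (cases "Y' e = s e")
          case True
          with Y' show ?thesis by blast
        next
          case False
          then have "Y' e = - s e" using Y'(4) sign_trichotomy[OF se] by blast
          then show ?thesis using symmetric[OF Y'(1)] Y' by (intro bexI[of _ "- Y'"]) auto
        qed
        then obtain Y' where Y': "Y' \<in> L" "Y' f = Zero" "\<forall>a\<in>A. Y' a = Zero" "Y' e = s e" by blast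
        have "improves s' f e (s e) p (composition Y Y')"
          by (rule improvesI) (use Y' Y True in \<open>auto simp: composition_def A_def\<close>)
        then show False using opt comp_closed[OF Y(1) Y'(1)] by blast
      qed
    qed
    have eF: "e \<notin> F p" using pe se by (auto simp: F_def)
    have FU: "F p \<subseteq> U" by (auto simp: F_def)
    have cardF: "card (F p) < card U"
      using eF eU FU less.prems(3) by (intro psubset_card_mono) auto
    have finF: "finite (F p)" using FU less.prems(3) finite_subset by blast
    have LF_iff: "T \<in> LF p e \<longleftrightarrow> (\<exists>X. X \<in> L \<and> X f = Zero \<and> restr (insert e (F p)) X = T)" for T
      by (auto simp: LF_def)
    have OMF: "oriented_matroid (insert e (F p)) (LF p e)"
      unfolding LF_def using oriented_matroid.restriction[OF contraction, of "insert e (F p)" f] finF by simp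
    have "generic (F p) (LF p e) e"
      unfolding generic_def
    proof (intro allI impI, elim conjE)
      fix A e' Y q
      assume A: "A \<subseteq> F p" "e' \<in> F p" and "Y \<in> LF p e" "q \<in> LF p e" and Ye: "Y e = Zero"
        and nz: "Y \<noteq> zero_vector" and z: "\<forall>a\<in>A. Y a = Zero \<and> q a = Zero" and qe': "q e' \<noteq> Zero"
      then obtain Y' q' where Y': "Y' \<in> L" "Y' f = Zero" "Y = restr (insert e (F p)) Y'"
        and q': "q' \<in> L" "q' f = Zero" "q = restr (insert e (F p)) q'" by (auto simp: LF_iff)
      have Y'nz: "Y' \<noteq> zero_vector" using nz Y'(3) by (auto simp: restr_def)
      have Y'z: "Y' a = Zero" if "a \<in> insert e A" for a
        using that z Ye A Y'(3) by (auto simp: restr_def split: if_splits)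
      have q'z: "q' a = Zero" if "a \<in> A" for a
        using that z A q'(3) by (auto simp: restr_def split: if_splits)
      have q'e': "q' e' \<noteq> Zero" using qe' A q'(3) by (auto simp: restr_def)
      have pz: "p a = Zero" if "a = e' \<or> a \<in> A" for a using that A by (auto simp: F_def)
      have "\<exists>r\<in>L. r e = Zero \<and> (\<forall>a\<in>A. r a = Zero) \<and> r e' \<noteq> Zero"
      proof (cases "q' e = Zero")
        case True
        then show ?thesis using q'(1) q'z q'e' by blast
      next
        case False
        \<comment> \<open>\<open>p\<close> vanishes on \<open>A\<close> and at \<open>e'\<close>,
          but not at \<open>e\<close>. So \<open>p\<close> or \<open>- p\<close> clears the entry of
          \<open>q'\<close> at \<open>e\<close> without affecting these. Genericity of
          \<open>f\<close> then replaces the result \<open>r\<close> by a covector in the section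
          \<open>f = 0\<close>.\<close>
        have "\<exists>p'\<in>L. p' e = - q' e \<and> (\<forall>a. a = e' \<or> a \<in> A \<longrightarrow> p' a = Zero)"
          using p(1) symmetric[OF p(1)] pz pe se sign_trichotomy[OF se, of "q' e"] False
          by (cases "q' e = s e") (force intro: bexI[of _ "- p"], force intro: bexI[of _ p])
        then obtain p' where p': "p' \<in> L" "p' e = - q' e" "\<And>a. a = e' \<or> a \<in> A \<Longrightarrow> p' a = Zero" by blast
        obtain r where r: "r \<in> L" "r e = Zero"
          "\<And>h. q' h = Zero \<or> p' h \<noteq> - q' h \<Longrightarrow> r h = (if q' h \<noteq> Zero then q' h else p' h)"
          using elimination[OF q'(1) p'(1) False p'(2)] by blast
        have "r e' \<noteq> Zero" using r(3)[of e'] p'(3)[of e'] q'e' by auto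
        moreover have "r a = Zero" if "a \<in> A" for a using r(3)[of a] p'(3)[of a] q'z that by auto
        ultimately show ?thesis using r by blast
      qed
      then obtain r where r: "r \<in> L" "r e = Zero" "\<forall>a\<in>A. r a = Zero" "r e' \<noteq> Zero" by blast
      have "\<exists>R\<in>L. R f = Zero \<and> (\<forall>a\<in>insert e A. R a = Zero) \<and> R e' \<noteq> Zero"
        using generic[unfolded generic_def, rule_format, of "insert e A" e' Y' r] A FU eU Y' Y'z Y'nz r
        by blast
      then obtain R where R: "R \<in> L" "R f = Zero" "\<forall>a\<in>insert e A. R a = Zero" "R e' \<noteq> Zero" by blast
      show "\<exists>Y'\<in>LF p e. Y' e = Zero \<and> (\<forall>a\<in>A. Y' a = Zero) \<and> Y' e' \<noteq> Zero"
        by (rule bexI[of _ "restr (insert e (F p)) R"]) (use R A in \<open>auto simp: restr_def LF_iff\<close>)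
    qed
    then have "\<exists>\<beta>. one_sided_scheme (F p) (LF p e) e (p e) \<beta>"
      using less.hyps[OF cardF OMF eF finF] less.prems(4) FU pe se inj_on_subset by metis
    then have scheme: "one_sided_scheme (F p) (LF p e) e (p e) (\<beta>F p e)"
      unfolding \<beta>F_def by (rule someI_ex)
    let ?s = "restr (F p) s"
    have "support ?s \<subseteq> F p" by (auto simp: support_def restr_def split: if_splits)
    moreover have "\<exists>T\<in>LF p e. ?s \<le> T"
    proof (rule bexI)
      show "restr (insert e (F p)) Z0 \<in> LF p e" using Z0 by (auto simp: LF_iff)
      have "Z0 h = s h" if "h \<in> F p" "s h \<noteq> Zero" for h
        using Z0(3)[of h] X0s[OF that(2)] that by (auto simp: F_def)
      then show "?s \<le> restr (insert e (F p)) Z0" by (auto simp: le_sign_vector_iff restr_def)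
    qed
    moreover have "T = zero_vector" if T: "T \<in> LF p e" "agrees ?s T" "T e \<noteq> - p e" for T
    proof -
      obtain Y where Y: "Y \<in> L" "Y f = Zero" "T = restr (insert e (F p)) Y" using T(1) by (auto simp: LF_iff)
      have "Y h \<noteq> - s h" if "h \<in> F p" "s h \<noteq> Zero" for h
        using T(2)[unfolded agrees_def, rule_format, of h] that Y(3) by (auto simp: restr_def)
      moreover have "Y e \<noteq> - s e" using T(3) Y(3) pe by (auto simp: restr_def)
      ultimately have "Y = zero_vector" using localised Y by blast
      then show ?thesis using Y(3) by (auto simp: restr_def)
    qed
    ultimately obtain W' where W': "W' \<subseteq> support ?s" "spans (LF p e) W'" "shatters (LF p e) W'"
      "\<beta>F p e W' \<in> LF p e" "?s \<le> \<beta>F p e W'"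
      using scheme[unfolded one_sided_scheme_def, rule_format, of ?s] by blast
    have W'F: "W' \<subseteq> F p" and W's: "W' \<subseteq> support s"
      using W'(1) by (auto simp: support_def restr_def split: if_splits)
    have spanning: "X = zero_vector" if "X \<in> L" "X f = Zero" "\<And>w. w \<in> W' \<Longrightarrow> X w = Zero" for X
    proof -
      have "restr (insert e (F p)) X = zero_vector"
      proof (rule W'(2)[unfolded spans_def, rule_format])
        show "restr (insert e (F p)) X \<in> LF p e" using that by (auto simp: LF_iff)
        show "restr (insert e (F p)) X w = Zero" if "w \<in> W'" for w
          using that \<open>\<And>w. w \<in> W' \<Longrightarrow> X w = Zero\<close> by (auto simp: restr_def)
      qed
      then have "X h = Zero" if "h \<in> insert e (F p)" for h using that unfolding restr_def by meson
      then show ?thesis using that se by (intro localised) auto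
    qed
    \<comment> \<open>The direction from \<open>p\<close> to \<open>q\<close> vanishes on
      \<open>W'\<close>, which spans the section \<open>f = 0\<close>.\<close>
    have unique: "q = p" if q: "q \<in> L" "q f = - \<tau>" "\<forall>w\<in>W'. q w = Zero" for q
    proof -
      obtain Z where Z: "Z \<in> L" "Z f = Zero"
        "\<And>h. q h = Zero \<or> p h \<noteq> q h \<Longrightarrow> Z h = (if q h \<noteq> Zero then q h else - p h)"
        using elimination_uminus[OF q(1) p(1), of f] q(2) p(3) \<tau> by auto
      have "Z w = Zero" if "w \<in> W'" for w
        using Z(3)[of w] q(3) W'F that by (auto simp: F_def)
      then have "Z = zero_vector" using spanning Z by blast
      then have "q h = p h" for h using Z(3)[of h] by (metis sign_uminus_eq_Zero)
      then show ?thesis by (rule ext)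
    qed
    let ?W = "insert e W'"
    have eW: "e \<notin> W'" using W'F eF by blast
    have "\<beta> ?W = composition p (lift p e (\<beta>F p e W'))"
    proof -
      have Ws: "?W \<subseteq> support s" using W's es by blast
      have finW: "finite ?W" by (rule finite_subset[OF Ws fin])
      have m: "arg_min_on ord ?W \<in> ?W" "\<not> (\<exists>x\<in>?W. ord x < ord (arg_min_on ord ?W))"
        using arg_min_if_finite[OF finW insert_not_empty, of ord] by blast+
      have "\<not> ord (arg_min_on ord ?W) < ord e"
        using arg_min_if_finite(2)[OF fin False, of ord] subsetD[OF Ws m(1)] by (fold e_def) blast
      then have "ord (arg_min_on ord ?W) = ord e" using m(2) by (metis insertI1 linorder_neqE_nat)
      then have "arg_min_on ord ?W = e"
        using inj_onD[OF less.prems(4)] subsetD[OF sU] subsetD[OF Ws m(1)] eU by metis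
      moreover have "vertex W' = p"
        unfolding vertex_def
      proof (rule some_equality)
        show "p \<in> L \<and> p f = - \<tau> \<and> (\<forall>w\<in>W'. p w = Zero)" using p(1,3) W'F by (auto simp: F_def)
      qed (use unique in blast)
      moreover have "?W - {e} = W'" using eW by auto
      ultimately show ?thesis by (simp add: \<beta>_def Let_def)
    qed
    moreover define X where "X = lift p e (\<beta>F p e W')"
    ultimately have \<beta>W: "\<beta> ?W = composition p X" by simp
    have X: "X \<in> L \<and> X f = Zero \<and> restr (insert e (F p)) X = \<beta>F p e W'"
      unfolding X_def lift_def using W'(4)[unfolded LF_iff] by (rule someI_ex)
    have "s \<le> composition p X"
    proof (rule le_composition_face[OF p_agrees])
      fix h assume h: "s h \<noteq> Zero" "p h = Zero"
      then have "h \<in> F p" using sU by (auto simp: F_def support_def)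
      moreover from this have "\<beta>F p e W' h = s h"
        using W'(5)[unfolded le_sign_vector_iff, rule_format, of h] h by (simp add: restr_def)
      moreover have "\<beta>F p e W' = restr (insert e (F p)) X" using X by simp
      ultimately show "X h = s h" by (simp add: restr_def)
    qed
    moreover have "composition p X \<in> L" using comp_closed p X by blast
    moreover have "spans L ?W"
      unfolding spans_def
    proof (intro ballI impI)
      fix Y assume Y: "Y \<in> L" "\<forall>w\<in>?W. Y w = Zero"
      have no: "Y' f \<noteq> - \<tau>" if Y': "Y' \<in> L" "\<forall>w\<in>?W. Y' w = Zero" for Y'
        using unique[of Y'] Y' pe se by (metis insertI1 insertI2)
      \<comment> \<open>Otherwise \<open>Y\<close> or \<open>- Y\<close> would be \<open>p\<close>,
        which does not vanish at \<open>e\<close>.\<close>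
      have "Y f = Zero"
        using no[OF Y] no[OF symmetric[OF Y(1)]] Y(2) sign_trichotomy[OF \<tau>, of "Y f"] by auto
      then show "Y = zero_vector" using spanning Y by blast
    qed
    moreover have "shatters L ?W"
      unfolding shatters_def
    proof (intro allI impI)
      fix t :: "'a \<Rightarrow> sign" assume t: "\<forall>w\<in>?W. t w \<noteq> Zero"
      then obtain T where T: "T \<in> LF p e" "\<forall>w\<in>W'. T w = t w"
        using W'(3) unfolding shatters_def by blast
      then obtain Y where Y: "Y \<in> L" "T = restr (insert e (F p)) Y" by (auto simp: LF_iff)
      have YW: "Y w = t w" if "w \<in> W'" for w using T(2)[rule_format, OF that] subsetD[OF W'F that] Y(2) by (simp add: restr_def)
      have pW: "p w = Zero" if "w \<in> W'" for w using that W'F by (auto simp: F_def)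
      \<comment> \<open>The sign at \<open>e\<close> is supplied by \<open>p\<close> or
        \<open>- p\<close>, both of which leave the signs on \<open>W'\<close> to
        \<open>Y\<close>.\<close>
      show "\<exists>X\<in>L. \<forall>w\<in>?W. X w = t w"
      proof (cases "t e = s e")
        case True
        then show ?thesis using comp_closed[OF p(1) Y(1)] YW pW pe se
          by (intro bexI[of _ "composition p Y"]) (auto simp: composition_def)
      next
        case False
        then have "t e = - s e" using t sign_trichotomy[OF se] by blast
        then show ?thesis using comp_closed[OF symmetric[OF p(1)] Y(1)] YW pW pe se
          by (intro bexI[of _ "composition (- p) Y"]) (auto simp: composition_def)
      qed
    qed
    moreover have "?W \<subseteq> support s" using W's es by blast
    ultimately show ?thesis unfolding \<beta>W[symmetric] by blast
  qed
  note encoded = this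
  have "one_sided_scheme U L f \<tau> \<beta>"
    unfolding one_sided_scheme_def
  proof (intro allI impI, elim conjE)
    fix s assume s: "support s \<subseteq> U" "\<exists>X\<in>L. s \<le> X"
      "\<forall>X\<in>L. agrees s X \<and> X f \<noteq> - \<tau> \<longrightarrow> X = zero_vector"
    show "\<exists>W\<subseteq>support s. spans L W \<and> shatters L W \<and> \<beta> W \<in> L \<and> s \<le> \<beta> W"
      by (rule encoded[OF s(1,2)]) (use s(3) in blast)
  qed
  then show ?case by blast
qed

section \<open>Compression of all samples\<close>

text \<open>Some covector above \<open>s\<close> is positive at the lexicographic element. Phrased
  through faces, this refers to no particular extension and applies to the section \<open>N\<close>
  as well.\<close>

definition meets_positive_side ::
  "'a set \<Rightarrow> ('a \<Rightarrow> nat) \<Rightarrow> ('a \<Rightarrow> sign) set \<Rightarrow> ('a \<Rightarrow> sign) \<Rightarrow> bool" where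
  "meets_positive_side U ord L s \<longleftrightarrow> (\<exists>X\<in>L. s \<le> X \<and> has_face U ord L X Plus)"

lemma spans_antimono: "spans L W \<Longrightarrow> N \<subseteq> L \<Longrightarrow> spans N W"
  unfolding spans_def by blast

lemma shatters_mono:
  assumes "shatters N W" "N \<subseteq> L"
  shows "shatters L W"
  unfolding shatters_def
proof (intro allI impI)
  fix t :: "'a \<Rightarrow> sign" assume "\<forall>w\<in>W. t w \<noteq> Zero"
  then obtain X where "X \<in> N" "\<forall>w\<in>W. X w = t w" using assms(1) unfolding shatters_def by metis
  then show "\<exists>X\<in>L. \<forall>w\<in>W. X w = t w" using assms(2) by blast
qed

lemma lexicographic_self:
  assumes "oriented_matroid U L" "inj_on ord U"
  shows "lexicographic U L U ord"
proof -
  interpret oriented_matroid U L by fact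
  show ?thesis
    by unfold_locales (use assms(2) covector_off_ground in \<open>auto simp: fun_eq_iff\<close>)
qed

text \<open>
  Let \<open>f\<close> be a generic element and \<open>N\<close> the section \<open>f = 0\<close>. A sample that meets the positive side of
  \<open>N\<close> is treated in \<open>N\<close>. For any other sample the generic objective \<open>g\<close> is bounded on \<open>f = +\<close>; at its
  maximum \<open>p\<close> the localisation is one-sided with respect to \<open>g\<close>. The two kinds are told apart by
  whether \<open>W\<close> spans \<open>N\<close>.
\<close>

lemma positive_scheme_exists:
  assumes "oriented_matroid U L" "f \<notin> U" "g \<notin> U" "f \<noteq> g" "inj_on (ord :: 'a \<Rightarrow> nat) U"
  shows "\<exists>\<beta>. \<forall>s. support s \<subseteq> U \<and> meets_positive_side U ord L s \<longrightarrow>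
    (\<exists>W\<subseteq>support s. \<not> spans L W \<and> shatters L W \<and> \<beta> W \<in> L \<and> s \<le> \<beta> W)"
  using assms(1)
\<comment> \<open>The section \<open>N\<close> has the ground set \<open>U\<close> again, so the
  number of covectors serves as the measure, and the same \<open>f\<close> and \<open>g\<close> are
  fresh at every level.\<close>
proof (induction "card L" arbitrary: L rule: less_induct)
  case less
  interpret oriented_matroid U L by fact
  interpret lex: lexicographic U L U ord by (rule lexicographic_self[OF less.prems assms(5)])
  note f = assms(2) and g = assms(3) and fg = assms(4)
  define L1 where "L1 = lext U ord L f"
  interpret M1: oriented_matroid "insert f U" L1
    unfolding L1_def by (rule lex.oriented_matroid_lext[OF f])
  have L1_del: "X(f := Zero) \<in> L" if "X \<in> L1" for X
    using lex.lext_deletion[OF f] that by (simp add: L1_def)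
  interpret lex1: lexicographic "insert f U" L1 U ord
  proof
    fix X assume X: "X \<in> L1" "X \<noteq> zero_vector"
    obtain t where "t \<noteq> Zero" "X f \<noteq> - t" by (cases "X f") (auto intro: that)
    then have "has_face U ord L (X(f := Zero)) t"
      using lex.lext_has_face[OF f] X by (simp add: L1_def)
    then show "\<exists>e\<in>U. X e \<noteq> Zero" by (metis has_face_nonzero fun_upd_apply)
  qed (use assms(5) in auto)
  have g1: "g \<notin> insert f U" using g fg by auto
  define L2 where "L2 = lext U ord L1 g"
  interpret M2: oriented_matroid "insert g (insert f U)" L2
    unfolding L2_def by (rule lex1.oriented_matroid_lext[OF g1])
  have L2_del: "X(g := Zero) \<in> L1" if "X \<in> L2" for X
    using lex1.lext_deletion[OF g1] that by (simp add: L2_def)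
  define N where "N = {X \<in> L1. X f = Zero}"
  have NL: "N \<subseteq> L" using L1_del by (auto simp: N_def) (metis fun_upd_triv)
  interpret N: oriented_matroid U N
  proof -
    interpret c: oriented_matroid "insert f U" N unfolding N_def by (rule M1.contraction)
    show "oriented_matroid U N"
    proof
      fix X Y e assume "X \<in> N" "Y \<in> N" "e \<in> Sep X Y"
      from c.strong_elimination[OF this]
      show "\<exists>Z\<in>N. Z e = Zero \<and> (\<forall>h\<in>U - Sep X Y. Z h = composition X Y h)" by blast
    qed (use covectors NL finite_ground c.comp_closed c.symmetric in auto)
  qed
  show ?case
  proof (cases "L \<subseteq> {zero_vector}")
    case True
    have "\<not> meets_positive_side U ord L s" for s
      using True has_face_nonzero unfolding meets_positive_side_def by fastforce
    then show ?thesis by blast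
  next
    case False
    have finL: "finite L"
    proof -
      have "L \<subseteq> (\<lambda>A h. if h \<in> fst A then Plus else if h \<in> snd A then Minus else Zero) ` (Pow U \<times> Pow U)"
      proof
        fix X assume X: "X \<in> L"
        show "X \<in> (\<lambda>A h. if h \<in> fst A then Plus else if h \<in> snd A then Minus else Zero) ` (Pow U \<times> Pow U)"
        proof (rule image_eqI)
          show "X = (\<lambda>A h. if h \<in> fst A then Plus else if h \<in> snd A then Minus else Zero)
            ({h. X h = Plus}, {h. X h = Minus})"
            by (rule ext) (simp, metis sign.exhaust)
          show "({h. X h = Plus}, {h. X h = Minus}) \<in> Pow U \<times> Pow U"
            using covector_off_ground[OF X] by force
        qed
      qed
      then show ?thesis by (rule finite_subset) (use finite_ground in simp)
    qed
    \<comment> \<open>A nonzero covector of minimal support has no nonzero face but itself, hence a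
      single leading sign, and so cannot vanish at \<open>f\<close>.\<close>
    have "N \<noteq> L"
    proof
      assume NL': "N = L"
      obtain Y0 where "Y0 \<in> L \<and> Y0 \<noteq> zero_vector" using False by blast
      from ex_has_least_nat[of "\<lambda>Y. Y \<in> L \<and> Y \<noteq> zero_vector", OF this, of "\<lambda>Y. card (support Y)"]
      obtain Y where Y: "Y \<in> L" "Y \<noteq> zero_vector"
        and least: "\<And>Z. Z \<in> L \<Longrightarrow> Z \<noteq> zero_vector \<Longrightarrow> card (support Y) \<le> card (support Z)" by blast
      have "Y \<in> L1" "Y f = Zero" using Y NL' by (auto simp: N_def)
      moreover from this have "Y(f := Zero) = Y" by auto
      ultimately have faces: "has_face U ord L Y Plus" "has_face U ord L Y Minus"
        using lex.lext_has_face[OF f, of Y Plus] lex.lext_has_face[OF f, of Y Minus] Y(2)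
        by (auto simp: L1_def)
      have "leads U ord Y t" if face: "has_face U ord L Y t" for t
      proof -
        obtain Z where Z: "Z \<in> L" "Z \<le> Y" "leads U ord Z t"
          using face unfolding has_face_def by blast
        have "Z \<noteq> zero_vector" using Z(3) by (auto simp: leads_def)
        moreover have "support Z \<subseteq> support Y"
          using Z(2) by (auto simp: support_def le_sign_vector_iff)
        moreover have "finite (support Y)"
          using covectors Y(1) finite_ground unfolding sign_vectors_def by (blast intro: finite_subset)
        ultimately have "support Z = support Y" using least[OF Z(1)] card_seteq by blast
        then have "Z h = Y h" for h
          using Z(2) by (cases "Z h = Zero") (auto simp: support_def le_sign_vector_iff)
        then have "Z = Y" by (rule ext)
        then show ?thesis using Z(3) by simp
      qed
      then have "leads U ord Y Plus" "leads U ord Y Minus" using faces by auto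
      then show False using leads_unique[OF assms(5)] by blast
    qed
    then have "card N < card L" using NL finL by (intro psubset_card_mono) auto
    then obtain \<beta>N where \<beta>N: "\<And>s. support s \<subseteq> U \<Longrightarrow> meets_positive_side U ord N s \<Longrightarrow>
      \<exists>W\<subseteq>support s. \<not> spans N W \<and> shatters N W \<and> \<beta>N W \<in> N \<and> s \<le> \<beta>N W"
      using less.hyps[OF _ N.oriented_matroid_axioms] by blast
    define F where "F p = {h\<in>U. p h = Zero}" for p :: "'a \<Rightarrow> sign"
    define LF where "LF p = restr (insert g (F p)) ` {X \<in> L2. X f = Zero}" for p :: "'a \<Rightarrow> sign"
    define \<beta>F where "\<beta>F p = (SOME \<beta>. one_sided_scheme (F p) (LF p) g Plus \<beta>)" for p :: "'a \<Rightarrow> sign"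
    \<comment> \<open>The vertex is sought in \<open>L1\<close>, where it is unique because
      \<open>W\<close> spans \<open>N\<close>. The optimum lies in \<open>L2\<close>, but dropping
      its sign at \<open>g\<close> does not change the decoded covector, which is restricted to
      \<open>U\<close>.\<close>
    define vertex where "vertex W = (SOME p. p \<in> L1 \<and> p f = Plus \<and> (\<forall>w\<in>W. p w = Zero))" for W
    define lift where "lift p T = (SOME X. X \<in> L2 \<and> X f = Zero \<and> restr (insert g (F p)) X = T)" for p T
    define \<beta> where "\<beta> W = (if spans N W
      then restr U (composition (vertex W) (lift (vertex W) (\<beta>F (vertex W) W))) else \<beta>N W)" for W
    have "\<exists>W\<subseteq>support s. \<not> spans L W \<and> shatters L W \<and> \<beta> W \<in> L \<and> s \<le> \<beta> W"
      if sU: "support s \<subseteq> U" and positive: "meets_positive_side U ord L s" for s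
    proof (cases "meets_positive_side U ord N s")
      case True
      then obtain W where "W \<subseteq> support s" "\<not> spans N W" "shatters N W" "\<beta>N W \<in> N" "s \<le> \<beta>N W"
        using \<beta>N[OF sU] by blast
      moreover from this have "\<not> spans L W"
        using spans_antimono[OF _ NL] by blast
      moreover from \<open>shatters N W\<close> have "shatters L W"
        using NL by (rule shatters_mono)
      ultimately show ?thesis using NL by (intro exI[of _ W]) (auto simp: \<beta>_def)
    next
      case notN: False
      have sf: "s f = Zero" "s g = Zero" using sU f g by (auto simp: support_def)
      obtain X1 where X1: "X1 \<in> L" "s \<le> X1" "has_face U ord L X1 Plus"
        using positive by (auto simp: meets_positive_side_def)
      have "X1(f := Plus) \<in> L1" using lex.lext_upd[OF f X1(1) _ X1(3)] by (simp add: L1_def)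
      then obtain u where u: "(X1(f := Plus))(g := u) \<in> L2"
        using lex1.lext_lift[OF g1] by (metis L2_def)
      define X0 where "X0 = (X1(f := Plus))(g := u)"
      have X0: "X0 \<in> L2" "X0 f = Plus" using u fg by (auto simp: X0_def)
      have X0s: "X0 h = s h" if "s h \<noteq> Zero" for h
        using that X1(2) sf by (auto simp: X0_def le_sign_vector_iff)
      have "agrees s X0" using X0s by (auto simp: agrees_def)
      moreover have "finite (support s)" using sU finite_ground finite_subset by blast
      \<comment> \<open>An unbounded direction has a face with leading sign \<open>Plus\<close>
        inside \<open>N\<close>. Composed with \<open>X1\<close> it gives a member of
        \<open>N\<close> above \<open>s\<close> with that face, against \<open>notN\<close>.\<close>
      moreover have "\<not> (\<exists>Y\<in>L2. Y f = Zero \<and> Y g = Plus \<and> agrees s Y)"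
      proof
        assume "\<exists>Y\<in>L2. Y f = Zero \<and> Y g = Plus \<and> agrees s Y"
        then obtain Y where Y: "Y \<in> L2" "Y f = Zero" "Y g = Plus" "agrees s Y" by blast
        let ?Y = "Y(g := Zero)"
        have nz: "Y \<noteq> zero_vector" using Y(3) by auto
        have YN: "?Y \<in> N" using L2_del[OF Y(1)] Y(2) fg by (auto simp: N_def)
        have "has_face U ord L1 ?Y Plus"
          using lex1.lext_has_face[OF g1, of Y Plus] Y nz by (simp add: L2_def)
        then obtain P where P: "P \<in> L1" "P \<le> ?Y" "leads U ord P Plus" by (auto simp: has_face_def)
        have "P f = Zero" using P(2) Y(2) fg unfolding le_sign_vector_iff by (metis fun_upd_other)
        then have PN: "P \<in> N" using P(1) by (simp add: N_def)
        have nz': "?Y \<noteq> zero_vector" using P(2,3) unfolding leads_def le_sign_vector_iff by metis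
        have YL: "?Y \<in> L" using YN NL by blast
        have "(?Y)(f := Zero) = ?Y" using Y(2) fg by auto
        then have faces: "has_face U ord L ?Y Plus" "has_face U ord L ?Y Minus"
          using lex.lext_has_face[OF f, of ?Y Plus] lex.lext_has_face[OF f, of ?Y Minus] YN nz' Y(2) fg
          by (auto simp: L1_def N_def)
        let ?C = "composition ?Y X1"
        have le: "?Y \<le> ?C" by (auto simp: le_sign_vector_iff composition_def)
        have "?C \<in> L" using comp_closed YL X1 by blast
        then have "?C \<in> L1"
          unfolding L1_def using lex.lext_both[OF f] faces has_face_mono[OF _ order_refl le] by blast
        moreover have "?C f = Zero"
          using Y(2) fg lex.covector_fresh[OF f X1(1)] by (simp add: composition_apply)
        ultimately have "?C \<in> N" by (simp add: N_def)
        moreover have "agrees s ?Y" using Y(4) sf by (auto simp: agrees_def)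
        then have "s \<le> ?C" using le_composition X1(2) by blast
        moreover have "has_face U ord N ?C Plus"
          unfolding has_face_def using PN P order_trans[OF P(2) le] by blast
        ultimately show False using notN by (auto simp: meets_positive_side_def)
      qed
      ultimately obtain p where p: "p \<in> L2" "agrees s p" "p f = Plus"
        and opt: "\<And>Y. Y \<in> L2 \<Longrightarrow> \<not> improves s f g Plus p Y"
        using optimum_exists[OF M2.oriented_matroid_axioms, of s g Plus Plus f] X0 sf(2) by blast
      \<comment> \<open>In a lexicographic extension a zero at \<open>g\<close> can be raised to
        \<open>Plus\<close>, since a nonzero covector with that zero has faces of both leading
        signs. The raised covector would improve \<open>p\<close>.\<close>
      have localised: "Y = zero_vector"
        if Y: "Y \<in> L2" "Y f = Zero" "Y g \<noteq> Minus" "\<And>h. h \<in> F p \<Longrightarrow> s h \<noteq> Zero \<Longrightarrow> Y h \<noteq> - s h" for Y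
      proof (rule ccontr)
        assume nz: "Y \<noteq> zero_vector"
        then have "has_face U ord L1 (Y(g := Zero)) Plus"
          using lex1.lext_has_face[OF g1, of Y Plus] Y by (simp add: L2_def)
        then have "(Y(g := Zero))(g := Plus) \<in> L2"
          unfolding L2_def using lex1.lext_upd[OF g1] L2_del[OF Y(1)] by blast
        then have "Y(g := Plus) \<in> L2" by simp
        moreover have "improves s f g Plus p (Y(g := Plus))"
          using Y(2,4) sU fg sf by (auto simp: improves_def F_def support_def)
        ultimately show False using opt by blast
      qed
      obtain Z0 where Z0: "Z0 \<in> L2" "Z0 f = Zero"
        "\<And>h. X0 h = Zero \<or> p h \<noteq> X0 h \<Longrightarrow> Z0 h = (if X0 h \<noteq> Zero then X0 h else - p h)"
        using M2.elimination_uminus[OF X0(1) p(1), of f] X0(2) p(3) by auto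
      have FU: "F p \<subseteq> U" by (auto simp: F_def)
      have finF: "finite (F p)" using FU finite_ground finite_subset by blast
      have gF: "g \<notin> F p" using FU g by blast
      have LF_iff: "T \<in> LF p \<longleftrightarrow> (\<exists>X. X \<in> L2 \<and> X f = Zero \<and> restr (insert g (F p)) X = T)" for T
        by (auto simp: LF_def)
      have OMF: "oriented_matroid (insert g (F p)) (LF p)"
        unfolding LF_def
        using oriented_matroid.restriction[OF M2.contraction, of "insert g (F p)" f] finF by simp
      have gen: "generic (insert f U) L2 g" unfolding L2_def by (rule lex1.generic_lext[OF g1])
      have "generic (F p) (LF p) g"
        unfolding generic_def
      proof (intro allI impI, elim conjE)
        fix A e Y q
        assume A: "A \<subseteq> F p" "e \<in> F p" and "Y \<in> LF p" "q \<in> LF p" and Yg: "Y g = Zero"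
          and nz: "Y \<noteq> zero_vector" and z: "\<forall>a\<in>A. Y a = Zero \<and> q a = Zero" and qe: "q e \<noteq> Zero"
        then obtain Y' q' where Y': "Y' \<in> L2" "Y' f = Zero" "Y = restr (insert g (F p)) Y'"
          and q': "q' \<in> L2" "q' f = Zero" "q = restr (insert g (F p)) q'" by (auto simp: LF_iff)
        have Y'nz: "Y' \<noteq> zero_vector" using nz Y'(3) by (auto simp: restr_def)
        have Y'g: "Y' g = Zero" using Yg Y'(3) by (simp add: restr_def)
        have zz: "\<forall>a\<in>insert f A. Y' a = Zero \<and> q' a = Zero"
          using z A Y' q' by (auto simp: restr_def split: if_splits)
        have q'e: "q' e \<noteq> Zero" using qe A q'(3) by (auto simp: restr_def)
        \<comment> \<open>\<open>g\<close> is generic over a ground set that contains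
          \<open>f\<close>; adding \<open>f\<close> to \<open>A\<close> keeps the new covector in
          the section \<open>f = 0\<close>.\<close>
        have "insert f A \<subseteq> insert f U" "e \<in> insert f U" using A FU by auto
        then have "\<exists>R\<in>L2. R g = Zero \<and> (\<forall>a\<in>insert f A. R a = Zero) \<and> R e \<noteq> Zero"
          using gen[unfolded generic_def, rule_format, of "insert f A" e Y' q'] Y' q' Y'nz Y'g zz q'e
          by blast
        then obtain R where R: "R \<in> L2" "R g = Zero" "\<forall>a\<in>insert f A. R a = Zero" "R e \<noteq> Zero" by blast
        show "\<exists>Y'\<in>LF p. Y' g = Zero \<and> (\<forall>a\<in>A. Y' a = Zero) \<and> Y' e \<noteq> Zero"
          by (rule bexI[of _ "restr (insert g (F p)) R"]) (use R A in \<open>auto simp: restr_def LF_iff\<close>)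
      qed
      then have "\<exists>\<beta>. one_sided_scheme (F p) (LF p) g Plus \<beta>"
        using one_sided_scheme_exists[OF OMF gF finF] inj_on_subset[OF assms(5) FU] by blast
      then have scheme: "one_sided_scheme (F p) (LF p) g Plus (\<beta>F p)"
        unfolding \<beta>F_def by (rule someI_ex)
      let ?s = "restr (F p) s"
      have "support ?s \<subseteq> F p" by (auto simp: support_def restr_def split: if_splits)
      moreover have "\<exists>T\<in>LF p. ?s \<le> T"
      proof (rule bexI)
        show "restr (insert g (F p)) Z0 \<in> LF p" using Z0 by (auto simp: LF_iff)
        have "Z0 h = s h" if "h \<in> F p" "s h \<noteq> Zero" for h
          using Z0(3)[of h] X0s[OF that(2)] that by (auto simp: F_def)
        then show "?s \<le> restr (insert g (F p)) Z0" by (auto simp: le_sign_vector_iff restr_def)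
      qed
      moreover have "T = zero_vector" if T: "T \<in> LF p" "agrees ?s T" "T g \<noteq> - Plus" for T
      proof -
        obtain Y where Y: "Y \<in> L2" "Y f = Zero" "T = restr (insert g (F p)) Y" using T(1) by (auto simp: LF_iff)
        have "Y h \<noteq> - s h" if "h \<in> F p" "s h \<noteq> Zero" for h
          using T(2)[unfolded agrees_def, rule_format, of h] that Y(3) by (auto simp: restr_def)
        moreover have "Y g \<noteq> Minus" using T(3) Y(3) by (auto simp: restr_def)
        ultimately have "Y = zero_vector" using localised Y by blast
        then show ?thesis using Y(3) by (auto simp: restr_def)
      qed
      ultimately obtain W where W: "W \<subseteq> support ?s" "spans (LF p) W" "shatters (LF p) W"
        "\<beta>F p W \<in> LF p" "?s \<le> \<beta>F p W"
        using scheme[unfolded one_sided_scheme_def, rule_format, of ?s] by blast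
      have WF: "W \<subseteq> F p" and Ws: "W \<subseteq> support s"
        using W(1) by (auto simp: support_def restr_def split: if_splits)
      have spansN: "spans N W"
        unfolding spans_def
      proof (intro ballI impI)
        fix Y assume Y: "Y \<in> N" "\<forall>w\<in>W. Y w = Zero"
        then have Y1: "Y \<in> L1" "Y f = Zero" by (auto simp: N_def)
        obtain t where t: "Y(g := t) \<in> L2" using lex1.lext_lift[OF g1 Y1(1)] by (metis L2_def)
        let ?R = "restr (insert g (F p)) (Y(g := t))"
        have "?R = zero_vector"
        proof (rule W(2)[unfolded spans_def, rule_format])
          show "?R \<in> LF p" using t Y1(2) fg unfolding LF_iff by (intro exI[of _ "Y(g := t)"]) simp
          show "?R w = Zero" if "w \<in> W" for w
            using that Y(2) WF gF by (auto simp: restr_def)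
        qed
        then have z: "(Y(g := t)) h = Zero" if "h \<in> insert g (F p)" for h
          using that unfolding restr_def by meson
        have "Y(g := t) = zero_vector"
        proof (rule localised[OF t])
          show "(Y(g := t)) f = Zero" using Y1(2) fg by simp
          show "(Y(g := t)) g \<noteq> Minus" using z[of g] by simp
          show "(Y(g := t)) h \<noteq> - s h" if "h \<in> F p" "s h \<noteq> Zero" for h using z[of h] that by simp
        qed
        then have "Y h = Zero" for h
          using lex1.covector_fresh[OF g1 Y1(1)] by (metis fun_upd_other)
        then show "Y = zero_vector" by (rule ext)
      qed
      let ?p = "p(g := Zero)"
      have p1: "?p \<in> L1" "?p f = Plus" using L2_del[OF p(1)] p(3) fg by auto
      have pW: "?p w = Zero" if "w \<in> W" for w using that WF by (auto simp: F_def)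
      have "vertex W = ?p"
        unfolding vertex_def
      proof (rule some_equality)
        show "?p \<in> L1 \<and> ?p f = Plus \<and> (\<forall>w\<in>W. ?p w = Zero)" using p1 pW by blast
      next
        fix q assume q: "q \<in> L1 \<and> q f = Plus \<and> (\<forall>w\<in>W. q w = Zero)"
        then obtain Z where Z: "Z \<in> L1" "Z f = Zero"
          "\<And>h. q h = Zero \<or> ?p h \<noteq> q h \<Longrightarrow> Z h = (if q h \<noteq> Zero then q h else - ?p h)"
          using M1.elimination_uminus[of q ?p f] p1 by (metis sign.distinct(3))
        have "Z w = Zero" if "w \<in> W" for w
          using Z(3)[of w] q pW that by auto
        then have "Z = zero_vector"
          using spansN Z(1,2) unfolding spans_def N_def by blast
        then have "q h = ?p h" for h using Z(3)[of h] by (metis sign_uminus_eq_Zero)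
        then show "q = ?p" by (rule ext)
      qed
      moreover have Fp: "F ?p = F p" using g by (auto simp: F_def)
      moreover from Fp have "LF ?p = LF p" by (simp add: LF_def)
      moreover from Fp this have "\<beta>F ?p = \<beta>F p" by (simp add: \<beta>F_def)
      moreover define X where "X = lift ?p (\<beta>F p W)"
      ultimately have \<beta>W: "\<beta> W = restr U (composition ?p X)" using spansN by (simp add: \<beta>_def)
      have X: "X \<in> L2 \<and> X f = Zero \<and> restr (insert g (F p)) X = \<beta>F p W"
        unfolding X_def lift_def Fp using W(4)[unfolded LF_iff] by (rule someI_ex)
      have restr_L2: "restr U Y \<in> L" if "Y \<in> L2" for Y
      proof -
        have "(Y(g := Zero))(f := Zero) \<in> L" using that L2_del L1_del by blast
        moreover from this have "(Y(g := Zero))(f := Zero) = restr U Y"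
          using covector_off_ground[of "(Y(g := Zero))(f := Zero)"] f g
          by (auto simp: restr_def fun_eq_iff)
        ultimately show ?thesis by simp
      qed
      have eq: "restr U (composition ?p X) = restr U (composition p X)"
        using g by (auto simp: restr_def composition_def)
      have "\<beta> W \<in> L" unfolding \<beta>W eq using restr_L2 M2.comp_closed p(1) X by blast
      moreover have "s \<le> \<beta> W"
      proof -
        have "s \<le> composition p X"
        proof (rule le_composition_face[OF p(2)])
          fix h assume h: "s h \<noteq> Zero" "p h = Zero"
          then have "h \<in> F p" using sU by (auto simp: F_def support_def)
          moreover from this have "\<beta>F p W h = s h"
            using W(5)[unfolded le_sign_vector_iff, rule_format, of h] h by (simp add: restr_def)
          moreover have "\<beta>F p W = restr (insert g (F p)) X" using X by simp
          ultimately show "X h = s h" by (simp add: restr_def)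
        qed
        then show ?thesis unfolding \<beta>W eq using sU
          by (auto simp: le_sign_vector_iff restr_def support_def)
      qed
      \<comment> \<open>The point \<open>p\<close> itself vanishes on \<open>W\<close>, and its
        restriction to \<open>U\<close> is nonzero because nonzero covectors of \<open>L1\<close>
        are nonzero on \<open>U\<close>.\<close>
      moreover have "\<not> spans L W"
      proof
        assume "spans L W"
        moreover have "restr U p \<in> L" using restr_L2 p(1) by blast
        moreover have "\<forall>w\<in>W. restr U p w = Zero" using WF by (auto simp: restr_def F_def)
        ultimately have "restr U p = zero_vector" unfolding spans_def by blast
        then have "?p h = Zero" if "h \<in> U" for h
          using that unfolding restr_def by (metis fun_upd_apply)
        then show False using lex1.nonzero_on_B[OF p1(1)] p1(2) by (metis sign.distinct(3))
      qed
      moreover have "shatters L W"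
        unfolding shatters_def
      proof (intro allI impI)
        fix t :: "'a \<Rightarrow> sign" assume "\<forall>w\<in>W. t w \<noteq> Zero"
        then obtain T where T: "T \<in> LF p" "\<forall>w\<in>W. T w = t w"
          using W(3) unfolding shatters_def by blast
        then obtain Y where Y: "Y \<in> L2" "T = restr (insert g (F p)) Y" by (auto simp: LF_iff)
        have "restr U Y w = t w" if "w \<in> W" for w
          using T(2)[rule_format, OF that] subsetD[OF WF that] FU Y(2) by (auto simp: restr_def)
        then show "\<exists>X\<in>L. \<forall>w\<in>W. X w = t w" using restr_L2[OF Y(1)] by blast
      qed
      ultimately show ?thesis using Ws by blast
    qed
    then show ?thesis by blast
  qed
qed

text \<open>The samples that \<open>positive_scheme_exists\<close> leaves over are one-sided for the
  lexicographic element. They receive spanning sets, the others non-spanning ones, so the decoder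
  can tell them apart.\<close>

lemma scheme_exists_if_fresh:
  assumes "oriented_matroid U L" "f \<notin> U" "g \<notin> U" "f \<noteq> g" "inj_on (ord :: 'a \<Rightarrow> nat) U"
  shows "\<exists>\<beta>. \<forall>s. support s \<subseteq> U \<and> (\<exists>X\<in>L. s \<le> X) \<longrightarrow>
    (\<exists>W\<subseteq>support s. shatters L W \<and> \<beta> W \<in> L \<and> s \<le> \<beta> W)"
proof -
  interpret oriented_matroid U L by fact
  interpret lex: lexicographic U L U ord by (rule lexicographic_self[OF assms(1,5)])
  note f = assms(2)
  define L1 where "L1 = lext U ord L f"
  obtain \<beta>P where \<beta>P: "\<And>s. support s \<subseteq> U \<Longrightarrow> meets_positive_side U ord L s \<Longrightarrow>
    \<exists>W\<subseteq>support s. \<not> spans L W \<and> shatters L W \<and> \<beta>P W \<in> L \<and> s \<le> \<beta>P W"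
    using positive_scheme_exists[OF assms] by blast
  obtain \<beta>N where \<beta>N: "one_sided_scheme U L1 f Plus \<beta>N"
    using one_sided_scheme_exists[OF lex.oriented_matroid_lext[OF f] f finite_ground assms(5)
      lex.generic_lext[OF f], of Plus] by (auto simp: L1_def)
  define \<beta> where "\<beta> W = (if spans L W then (\<beta>N W)(f := Zero) else \<beta>P W)" for W
  have "\<exists>W\<subseteq>support s. shatters L W \<and> \<beta> W \<in> L \<and> s \<le> \<beta> W"
    if sU: "support s \<subseteq> U" and "\<exists>X\<in>L. s \<le> X" for s
  proof (cases "meets_positive_side U ord L s")
    case True
    then show ?thesis using \<beta>P[OF sU True] by (metis \<beta>_def)
  next
    case False
    obtain X0 where X0: "X0 \<in> L" "s \<le> X0" using \<open>\<exists>X\<in>L. s \<le> X\<close> by blast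
    have sf: "s f = Zero" using sU f by (auto simp: support_def)
    obtain t where t: "X0(f := t) \<in> L1" using lex.lext_lift[OF f X0(1)] by (metis L1_def)
    have "s \<le> X0(f := t)" using X0(2) sf by (auto simp: le_sign_vector_iff)
    moreover have "X = zero_vector" if X: "X \<in> L1" "agrees s X" "X f \<noteq> - Plus" for X
    proof (rule ccontr)
      assume "X \<noteq> zero_vector"
      then have face: "has_face U ord L (X(f := Zero)) Plus"
        using lex.lext_has_face[OF f, of X Plus] X by (simp add: L1_def)
      let ?C = "composition (X(f := Zero)) X0"
      have "X(f := Zero) \<le> ?C" by (auto simp: le_sign_vector_iff composition_def)
      then have "has_face U ord L ?C Plus" using face has_face_mono by blast
      moreover have "X(f := Zero) \<in> L" using lex.lext_deletion[OF f] X(1) by (simp add: L1_def)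
      then have "?C \<in> L" using comp_closed X0(1) by blast
      moreover have "agrees s (X(f := Zero))" using X(2) sf by (auto simp: agrees_def)
      then have "s \<le> ?C" using le_composition X0(2) by blast
      ultimately show False using False by (auto simp: meets_positive_side_def)
    qed
    ultimately obtain W where W: "W \<subseteq> support s" "spans L1 W" "shatters L1 W" "\<beta>N W \<in> L1" "s \<le> \<beta>N W"
      using \<beta>N[unfolded one_sided_scheme_def, rule_format, of s] sU t by blast
    have fW: "w \<noteq> f" if "w \<in> W" for w using that W(1) sU f by blast
    have del: "X(f := Zero) \<in> L" if "X \<in> L1" for X
      using lex.lext_deletion[OF f] that by (simp add: L1_def)
    have "spans L W"
      unfolding spans_def
    proof (intro ballI impI)
      fix X assume X: "X \<in> L" "\<forall>w\<in>W. X w = Zero"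
      obtain t where t: "X(f := t) \<in> L1" using lex.lext_lift[OF f X(1)] by (metis L1_def)
      then have "X(f := t) = zero_vector"
        using W(2)[unfolded spans_def, rule_format, OF t] X(2) fW by auto
      then have "X h = Zero" for h
        using lex.covector_fresh[OF f X(1)] by (metis fun_upd_other)
      then show "X = zero_vector" by (rule ext)
    qed
    then have "\<beta> W = (\<beta>N W)(f := Zero)" by (simp add: \<beta>_def)
    then have "\<beta> W \<in> L" "s \<le> \<beta> W" using del[OF W(4)] W(5) sf by (auto simp: le_sign_vector_iff)
    moreover have "shatters L W"
      unfolding shatters_def
    proof (intro allI impI)
      fix t :: "'a \<Rightarrow> sign" assume "\<forall>w\<in>W. t w \<noteq> Zero"
      then obtain X where X: "X \<in> L1" "\<forall>w\<in>W. X w = t w" using W(3) unfolding shatters_def by metis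
      then show "\<exists>X\<in>L. \<forall>w\<in>W. X w = t w"
        using del[OF X(1)] fW by (intro bexI[of _ "X(f := Zero)"]) auto
    qed
    ultimately show ?thesis using W(1) by blast
  qed
  then show ?thesis by blast
qed

text \<open>The type may contain no elements outside \<open>U\<close>. The sum with
  \<open>bool\<close> supplies the two fresh ones, and \<open>\<iota>\<close> carries the covectors
  over.\<close>

lemma scheme_exists:
  assumes "oriented_matroid U (L :: ('a \<Rightarrow> sign) set)"
  shows "\<exists>\<beta>. \<forall>s. support s \<subseteq> U \<and> (\<exists>X\<in>L. s \<le> X) \<longrightarrow>
    (\<exists>W\<subseteq>support s. shatters L W \<and> \<beta> W \<in> L \<and> s \<le> \<beta> W)"
proof -
  interpret oriented_matroid U L by fact
  define \<iota> :: "('a \<Rightarrow> sign) \<Rightarrow> 'a + bool \<Rightarrow> sign" where "\<iota> X = case_sum X (\<lambda>_. Zero)" for X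
  have \<iota>_simps [simp]: "\<iota> X (Inl h) = X h" "\<iota> X (Inr b) = Zero" for X h b
    by (simp_all add: \<iota>_def)
  have sum_eqI: "X = Y" if "\<And>h. X (Inl h) = Y (Inl h)" "\<And>b. X (Inr b) = Y (Inr b)"
    for X Y :: "'a + bool \<Rightarrow> sign"
    by (rule ext) (metis that sum.exhaust)
  have "oriented_matroid (Inl ` U) (\<iota> ` L)"
  proof
    show "finite ((Inl :: 'a \<Rightarrow> 'a + bool) ` U)" using finite_ground by simp
    show "\<iota> ` L \<subseteq> sign_vectors (Inl ` U)"
    proof (clarsimp simp: sign_vectors_def support_def)
      fix X and h :: "'a + bool" assume "X \<in> L" "\<iota> X h \<noteq> Zero"
      then show "h \<in> Inl ` U" using covector_off_ground by (cases h) auto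
    qed
  next
    fix X Y assume "X \<in> \<iota> ` L" "Y \<in> \<iota> ` L"
    then obtain X' Y' where XY: "X' \<in> L" "Y' \<in> L" "X = \<iota> X'" "Y = \<iota> Y'" by blast
    then have "composition X Y = \<iota> (composition X' Y')"
      by (intro sum_eqI) (simp_all add: composition_apply)
    then show "composition X Y \<in> \<iota> ` L" using comp_closed XY by blast
  next
    fix X Y e assume "X \<in> \<iota> ` L" "Y \<in> \<iota> ` L" and e: "e \<in> Sep X Y"
    then obtain X' Y' where XY: "X' \<in> L" "Y' \<in> L" "X = \<iota> X'" "Y = \<iota> Y'" by blast
    then obtain e' where e': "e = Inl e'" "X' e' \<noteq> Zero" "Y' e' = - X' e'"
      using e by (cases e) (auto simp: in_Sep_iff)
    obtain Z where Z: "Z \<in> L" "Z e' = Zero"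
      "\<And>h. X' h = Zero \<or> Y' h \<noteq> - X' h \<Longrightarrow> Z h = (if X' h \<noteq> Zero then X' h else Y' h)"
      using elimination[OF XY(1,2) e'(2,3)] by blast
    show "\<exists>Z\<in>\<iota> ` L. Z e = Zero \<and> (\<forall>h\<in>Inl ` U - Sep X Y. Z h = composition X Y h)"
      by (rule bexI[of _ "\<iota> Z"]) (use Z e' XY in \<open>auto simp: in_Sep_iff composition_apply\<close>)
  next
    fix X assume "X \<in> \<iota> ` L"
    then obtain X' where X: "X' \<in> L" "X = \<iota> X'" by blast
    then have "- X = \<iota> (- X')" by (intro sum_eqI) simp_all
    then show "- X \<in> \<iota> ` L" using symmetric X by blast
  qed
  moreover obtain ord :: "'a + bool \<Rightarrow> nat" where "inj_on ord (Inl ` U)"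
    using finite_imp_inj_to_nat_seg[of "Inl ` U"] finite_ground by blast
  ultimately have "\<exists>\<beta>. \<forall>s. support s \<subseteq> Inl ` U \<and> (\<exists>X\<in>\<iota> ` L. s \<le> X) \<longrightarrow>
      (\<exists>W\<subseteq>support s. shatters (\<iota> ` L) W \<and> \<beta> W \<in> \<iota> ` L \<and> s \<le> \<beta> W)"
    by (intro scheme_exists_if_fresh[of _ _ "Inr True" "Inr False" ord]) auto
  then obtain \<beta> where \<beta>: "\<forall>s. support s \<subseteq> Inl ` U \<and> (\<exists>X\<in>\<iota> ` L. s \<le> X) \<longrightarrow>
      (\<exists>W\<subseteq>support s. shatters (\<iota> ` L) W \<and> \<beta> W \<in> \<iota> ` L \<and> s \<le> \<beta> W)"
    by (rule exE)
  have \<iota>_le: "\<iota> s \<le> \<iota> X \<longleftrightarrow> s \<le> X" for s X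
  proof
    assume le: "\<iota> s \<le> \<iota> X"
    show "s \<le> X" unfolding le_fun_def
    proof
      fix h show "s h \<le> X h" using le[unfolded le_fun_def, rule_format, of "Inl h"] by simp
    qed
  next
    assume le: "s \<le> X"
    show "\<iota> s \<le> \<iota> X" unfolding le_fun_def
    proof
      fix h show "\<iota> s h \<le> \<iota> X h" using le[unfolded le_fun_def] by (cases h) auto
    qed
  qed
  define \<beta>' where "\<beta>' W = \<beta> (Inl ` W) \<circ> Inl" for W
  have "\<exists>W\<subseteq>support s. shatters L W \<and> \<beta>' W \<in> L \<and> s \<le> \<beta>' W"
    if sU: "support s \<subseteq> U" and X: "\<exists>X\<in>L. s \<le> X" for s
  proof -
    have supp: "support (\<iota> s) = Inl ` support s"
    proof (rule set_eqI)
      fix h show "h \<in> support (\<iota> s) \<longleftrightarrow> h \<in> Inl ` support s"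
        by (cases h) (auto simp: support_def)
    qed
    have "support (\<iota> s) \<subseteq> Inl ` U" using sU by (auto simp: supp)
    moreover have "\<exists>X\<in>\<iota> ` L. \<iota> s \<le> X" using X \<iota>_le by blast
    ultimately obtain W' where W': "W' \<subseteq> Inl ` support s" "shatters (\<iota> ` L) W'" "\<beta> W' \<in> \<iota> ` L" "\<iota> s \<le> \<beta> W'"
      using \<beta>[rule_format, of "\<iota> s"] unfolding supp by blast
    obtain W where W: "W \<subseteq> support s" "W' = Inl ` W" using W'(1) by (meson subset_imageE)
    obtain X where X: "X \<in> L" "\<beta> W' = \<iota> X" using W'(3) by blast
    have "\<beta>' W = X" by (auto simp: \<beta>'_def W(2)[symmetric] X(2))
    moreover have "shatters L W"
      unfolding shatters_def
    proof (intro allI impI)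
      fix t :: "'a \<Rightarrow> sign" assume "\<forall>w\<in>W. t w \<noteq> Zero"
      then have "\<forall>w\<in>W'. \<iota> t w \<noteq> Zero" by (simp add: W(2))
      then obtain Y where "Y \<in> L" "\<forall>w\<in>W'. \<iota> Y w = \<iota> t w"
        using W'(2)[unfolded shatters_def, rule_format, of "\<iota> t"] by blast
      then show "\<exists>X\<in>L. \<forall>w\<in>W. X w = t w" by (auto simp: W(2))
    qed
    ultimately show ?thesis using W(1) X W'(4) \<iota>_le by auto
  qed
  then show ?thesis by blast
qed

section \<open>Convex sets in the tope graph\<close>

definition diff :: "('a \<Rightarrow> sign) \<Rightarrow> ('a \<Rightarrow> sign) \<Rightarrow> 'a set" where
  "diff X Y = {e. X e \<noteq> Y e}"

lemma tope_iff: "T \<in> topes U L \<longleftrightarrow> T \<in> L \<and> (\<forall>e. T e \<noteq> Zero \<longleftrightarrow> e \<in> U)"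
  by (auto simp: topes_def full_sign_vectors_def support_def)

lemma cube_adjD: "cube_adj X Y \<Longrightarrow> X e \<noteq> Y e \<Longrightarrow> h \<noteq> e \<Longrightarrow> Y h = X h"
  unfolding cube_adj_def by metis

section \<open>Distances in the tope graph\<close>

context oriented_matroid
begin

lemma topes_diff:
  assumes "X \<in> topes U L" "Y \<in> topes U L"
  shows "e \<in> diff X Y \<longleftrightarrow> e \<in> U \<and> Y e = - X e"
proof (cases "e \<in> U")
  case True
  then have "X e \<noteq> Zero" "Y e \<noteq> Zero" using assms by (auto simp: tope_iff)
  then show ?thesis using True by (cases "X e"; cases "Y e") (simp_all add: diff_def)
next
  case False
  then have "X e = Zero" "Y e = Zero" using assms by (auto simp: tope_iff)
  then show ?thesis using False by (simp add: diff_def)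
qed

lemma finite_topes_diff: "X \<in> topes U L \<Longrightarrow> Y \<in> topes U L \<Longrightarrow> finite (diff X Y)"
  by (rule finite_subset[OF _ finite_ground]) (use topes_diff in blast)

lemma composition_tope: "X \<in> L \<Longrightarrow> T \<in> topes U L \<Longrightarrow> composition X T \<in> topes U L"
  using comp_closed covector_off_ground unfolding tope_iff composition_def by metis

lemma card_diff_walk:
  assumes "walk (topes U L) q"
  shows "card (diff (hd q) (last q)) < length q"
  using assms
proof (induction q)
  case Nil
  then show ?case by (simp add: walk_def)
next
  case (Cons X q)
  show ?case
  proof (cases "q = []")
    case True
    then show ?thesis by (simp add: diff_def)
  next
    case False
    have w: "walk (topes U L) q" and adj: "cube_adj X (hd q)" and V: "set (X # q) \<subseteq> topes U L"
      using Cons.prems False by (auto simp: walk_def successively_Cons)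
    obtain e where e: "X e \<noteq> hd q e" using adj by (auto simp: cube_adj_def)
    have "diff X (last q) \<subseteq> insert e (diff (hd q) (last q))"
      using cube_adjD[OF adj e] by (auto simp: diff_def)
    moreover have "finite (diff (hd q) (last q))"
      using V False by (intro finite_topes_diff) auto
    ultimately have "card (diff X (last q)) \<le> Suc (card (diff (hd q) (last q)))"
      by (metis card_insert_if card_mono finite_insert le_SucI)
    then show ?thesis using Cons.IH[OF w] False by simp
  qed
qed

end

context simple_oriented_matroid
begin

text \<open>Simplicity in the form in which it is used: seen from the signs \<open>x\<close> and
  \<open>x'\<close>, a covector crosses one of the two elements without the other. As the elements
  are not parallel, some \<open>V\<close> treats them differently, and \<open>V\<close> or
  \<open>- V\<close> does so on the opposite side.\<close>

lemma proper_intermediate_sign: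
  assumes "e \<in> U" "e' \<in> U" "e \<noteq> e'" "x \<noteq> Zero" "x' \<noteq> Zero"
  shows "\<exists>V\<in>L. (V e = - x \<and> V e' \<noteq> - x') \<or> (V e' = - x' \<and> V e \<noteq> - x)"
proof -
  have "\<exists>V\<in>L. \<not> (V e = x \<longleftrightarrow> V e' = x') \<or> \<not> (V e = - x \<longleftrightarrow> V e' = - x')"
  proof (cases "x = x'")
    case True
    obtain V where "V \<in> L" "V e \<noteq> V e'" using no_parallel[OF assms(1-3)] by blast
    then show ?thesis using sign_trichotomy[OF assms(4)] True by metis
  next
    case False
    obtain V where "V \<in> L" "V e \<noteq> - V e'" using no_parallel[OF assms(1-3)] by blast
    moreover have "x' = - x" using False assms sign_trichotomy[OF assms(4)] by blast
    ultimately show ?thesis using sign_trichotomy[OF assms(4)]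
      by (metis sign_uminus_uminus sign_uminus_eq_Zero)
  qed
  then obtain V where V: "V \<in> L" "\<not> (V e = x \<longleftrightarrow> V e' = x') \<or> \<not> (V e = - x \<longleftrightarrow> V e' = - x')" by blast
  show ?thesis
  proof (cases "V e = - x \<longleftrightarrow> V e' = - x'")
    case False
    then show ?thesis using V(1) by blast
  next
    case True
    then have "\<not> ((- V) e = - x \<longleftrightarrow> (- V) e' = - x')" using V(2) by simp
    then show ?thesis using symmetric[OF V(1)] by blast
  qed
qed

text \<open>For a \<open>Y\<close> with minimal difference to \<open>X\<close>, eliminating one
  differing element gives a \<open>Z\<close> that vanishes on the whole difference and equals
  \<open>X\<close> elsewhere. If two elements differed, \<open>Z\<close> followed by a covector
  crossing only one of them would lead to a tope strictly in between.\<close>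

lemma adjacent_tope_towards:
  assumes "X \<in> topes U L" "Y \<in> topes U L" "X \<noteq> Y"
  shows "\<exists>e. X e \<noteq> Y e \<and> X(e := Y e) \<in> topes U L"
  using assms(2,3)
proof (induction "card (diff X Y)" arbitrary: Y rule: less_induct)
  case less
  note X = assms(1) and Y = less.prems(1)
  have XL: "X \<in> L" "Y \<in> L" using X Y by (auto simp: tope_iff)
  note dXY = topes_diff[OF X Y]
  show ?case
  proof (cases "\<exists>T\<in>topes U L. T \<noteq> X \<and> diff X T \<subset> diff X Y")
    case True
    then obtain T where T: "T \<in> topes U L" "T \<noteq> X" "diff X T \<subset> diff X Y" by blast
    then have "card (diff X T) < card (diff X Y)"
      using finite_topes_diff[OF X Y] by (intro psubset_card_mono)
    then obtain e where e: "X e \<noteq> T e" "X(e := T e) \<in> topes U L" using less.hyps T by blast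
    then have "e \<in> diff X T" by (simp add: diff_def)
    moreover from this have "e \<in> diff X Y" using T(3) by blast
    ultimately have "T e = Y e" using topes_diff[OF X T(1)] dXY by metis
    with e show ?thesis by metis
  next
    case False
    then have minimal: "T = X \<or> diff X T = diff X Y"
      if "T \<in> topes U L" "diff X T \<subseteq> diff X Y" for T using that by blast
    obtain e where e: "e \<in> diff X Y" using less.prems(2) by (auto simp: diff_def)
    then have eU: "e \<in> U" "Y e = - X e" using dXY by auto
    have Xe: "X e \<noteq> Zero" using X eU(1) by (auto simp: tope_iff)
    obtain Z where Z: "Z \<in> L" "Z e = Zero"
      "\<And>h. X h = Zero \<or> Y h \<noteq> - X h \<Longrightarrow> Z h = (if X h \<noteq> Zero then X h else Y h)"
      using elimination[OF XL Xe eU(2)] by blast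
    have off: "Z h = X h" if "h \<notin> diff X Y" for h
      using that dXY[of h] Z(3)[of h] X Y by (auto simp: tope_iff diff_def)
    have "composition Z X \<in> topes U L" "composition Z Y \<in> topes U L"
      using composition_tope Z(1) X Y by blast+
    moreover have "diff X (composition Z X) \<subseteq> diff X Y" "diff X (composition Z Y) \<subseteq> diff X Y"
      using off by (auto simp: diff_def composition_def)
    moreover have "e \<notin> diff X (composition Z X)" "e \<in> diff X (composition Z Y)"
      using Z(2) e by (auto simp: diff_def composition_def)
    ultimately have ZX: "composition Z X = X" and ZY: "diff X (composition Z Y) = diff X Y"
      using minimal e by (blast, metis (no_types, lifting) diff_def mem_Collect_eq)
    have Zzero: "Z h = Zero" if "h \<in> diff X Y" for h
    proof (rule ccontr)
      assume "Z h \<noteq> Zero"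
      then have "composition Z X h = Z h" "composition Z Y h = Z h" by (auto simp: composition_apply)
      then have "h \<notin> diff X (composition Z Y)" using ZX by (simp add: diff_def)
      then show False using ZY that by blast
    qed
    have "diff X Y = {e}"
    proof (rule ccontr)
      assume "diff X Y \<noteq> {e}"
      then obtain e' where e': "e' \<in> diff X Y" "e' \<noteq> e" using e by blast
      then have e'U: "e' \<in> U" using dXY by blast
      have Xe': "X e' \<noteq> Zero" using X e'U by (auto simp: tope_iff)
      obtain V where V: "V \<in> L"
        "(V e = - X e \<and> V e' \<noteq> - X e') \<or> (V e' = - X e' \<and> V e \<noteq> - X e)"
        using proper_intermediate_sign[OF eU(1) e'U _ Xe Xe'] e'(2) by metis
      let ?T = "composition Z (composition V X)"
      have T: "?T \<in> topes U L" using composition_tope Z(1) V(1) X by blast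
      have "diff X ?T \<subseteq> diff X Y"
      proof
        fix h assume h: "h \<in> diff X ?T"
        then have "X h \<noteq> Zero" using topes_diff[OF X T] X by (auto simp: tope_iff)
        then show "h \<in> diff X Y" using h off[of h] by (auto simp: diff_def composition_apply)
      qed
      then have "?T = X \<or> diff X ?T = diff X Y" using minimal T by blast
      moreover have "?T e = (if V e = - X e then - X e else X e)"
        "?T e' = (if V e' = - X e' then - X e' else X e')"
        using Zzero[OF e] Zzero[OF e'(1)] sign_trichotomy[OF Xe, of "V e"] sign_trichotomy[OF Xe', of "V e'"]
        by (auto simp: composition_apply)
      ultimately show False using V(2) e e'(1) Xe Xe' unfolding diff_def
        by (metis (mono_tags, lifting) mem_Collect_eq sign_uminus_self_eq)
    qed
    then have "(X(e := Y e)) h = Y h" for h by (auto simp: diff_def)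
    then have "X(e := Y e) = Y" by (rule ext)
    then show ?thesis using Y e by (auto simp: diff_def)
  qed
qed

lemma diff_upd: "X e \<noteq> Y e \<Longrightarrow> diff (X(e := Y e)) Y = diff X Y - {e}"
  by (auto simp: diff_def)

text \<open>Together with \<open>card_diff_walk\<close> this identifies graph distance with Hamming
  distance: the tope graph is a partial cube.\<close>

lemma geodesic_exists:
  assumes "X \<in> topes U L" "Y \<in> topes U L"
  shows "\<exists>p. walk (topes U L) p \<and> hd p = X \<and> last p = Y \<and> length p = Suc (card (diff X Y))"
  using assms
proof (induction "card (diff X Y)" arbitrary: X)
  case 0
  then have "X = Y" using finite_topes_diff by (auto simp: diff_def)
  then show ?case using 0 by (intro exI[of _ "[X]"]) (auto simp: walk_def diff_def)
next
  case (Suc n)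
  then have "X \<noteq> Y" by (auto simp: diff_def)
  then obtain e where e: "X e \<noteq> Y e" "X(e := Y e) \<in> topes U L"
    using adjacent_tope_towards Suc.prems by blast
  have "e \<in> diff X Y" using e by (simp add: diff_def)
  then have "card (diff (X(e := Y e)) Y) = n"
    using Suc.hyps(2) e(1) finite_topes_diff[OF Suc.prems] by (simp add: diff_upd)
  then obtain p where p: "walk (topes U L) p" "hd p = X(e := Y e)" "last p = Y" "length p = Suc n"
    using Suc.hyps(1)[of "X(e := Y e)"] e(2) Suc.prems(2) by metis
  have "cube_adj X (X(e := Y e))"
    unfolding cube_adj_def by (rule ex1I[of _ e]) (use e in \<open>auto split: if_splits\<close>)
  then show ?case using p Suc
    by (intro exI[of _ "X # p"]) (auto simp: walk_def successively_Cons)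
qed

text \<open>Let an edge from \<open>X'\<close> in \<open>C\<close> to \<open>Y\<close> outside flip
  \<open>e\<close>. If \<open>Z\<close> in \<open>C\<close> were on the side of \<open>Y\<close>, a
  shortest path from \<open>Z\<close> to \<open>Y\<close> followed by \<open>X'\<close> would again
  be shortest, and convexity would put \<open>Y\<close> into \<open>C\<close>.\<close>

lemma convex_one_side_of_osc:
  assumes C: "C \<in> convex_sets (topes U L)" and "e \<in> osc (topes U L) C" "X \<in> C" "Z \<in> C"
  shows "Z e = X e"
proof -
  have CV: "C \<subseteq> topes U L" using C by (auto simp: convex_sets_def)
  obtain X' Y where Y: "X' \<in> C" "Y \<in> topes U L" "Y \<notin> C" "cube_adj X' Y" "X' e \<noteq> Y e"
    using assms(2) by (auto simp: osc_def)
  have "Z e = X' e" if "Z \<in> C" for Z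
  proof (rule ccontr)
    assume "Z e \<noteq> X' e"
    have V: "Z \<in> topes U L" "X' \<in> topes U L" using that Y(1) CV by auto
    have "e \<in> diff X' Y" "e \<in> diff X' Z" using Y(5) \<open>Z e \<noteq> X' e\<close> by (auto simp: diff_def)
    then have ZY: "Z e = Y e" using topes_diff[OF V(2) Y(2)] topes_diff[OF V(2,1)] by metis
    have "diff Z X' = insert e (diff Z Y)"
    proof (rule set_eqI)
      fix h show "h \<in> diff Z X' \<longleftrightarrow> h \<in> insert e (diff Z Y)"
        using cube_adjD[OF Y(4,5), of h] \<open>Z e \<noteq> X' e\<close> by (cases "h = e") (auto simp: diff_def)
    qed
    moreover have "e \<notin> diff Z Y" using ZY by (simp add: diff_def)
    ultimately have card: "card (diff Z X') = Suc (card (diff Z Y))"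
      using finite_topes_diff[OF V(1) Y(2)] by simp
    obtain p where p: "walk (topes U L) p" "hd p = Z" "last p = Y" "length p = Suc (card (diff Z Y))"
      using geodesic_exists[OF V(1) Y(2)] by blast
    have "cube_adj Y X'" using Y(4) unfolding cube_adj_def by metis
    then have walk: "walk (topes U L) (p @ [X'])"
      using p V(2) by (auto simp: walk_def successively_append_iff)
    have hd: "hd (p @ [X']) = Z" using p by (auto simp: walk_def)
    have "shortest_path (topes U L) (p @ [X'])"
      unfolding shortest_path_def
    proof (intro conjI allI impI walk)
      fix q assume "walk (topes U L) q \<and> hd q = hd (p @ [X']) \<and> last q = last (p @ [X'])"
      then show "length (p @ [X']) \<le> length q"
        using card_diff_walk[of q] card p(4) unfolding hd by auto
    qed
    moreover have "hd (p @ [X']) \<in> C" "last (p @ [X']) \<in> C" using hd that Y(1) by auto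
    ultimately have "set (p @ [X']) \<subseteq> C" using C unfolding convex_sets_def by blast
    moreover have "Y \<in> set p" using p by (metis walk_def last_in_set)
    ultimately show False using Y(3) by auto
  qed
  then show ?thesis using assms by metis
qed

text \<open>A walk from \<open>X\<close> towards \<open>T\<close> flips only elements on which the
  two differ, whereas leaving \<open>C\<close> would flip an osculating element. Thus
  \<open>C\<close> is the intersection of the halfspaces at its osculating elements.\<close>

lemma convex_contains:
  assumes C: "C \<in> convex_sets (topes U L)" and "X \<in> C" "T \<in> topes U L"
    and "\<And>e. e \<in> osc (topes U L) C \<Longrightarrow> T e = X e"
  shows "T \<in> C"
  using assms(2,4)
proof (induction "card (diff X T)" arbitrary: X rule: less_induct)
  case less
  have X: "X \<in> topes U L" using C less.prems by (auto simp: convex_sets_def)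
  show ?case
  proof (cases "X = T")
    case True
    then show ?thesis using less.prems by simp
  next
    case False
    then obtain e where e: "X e \<noteq> T e" "X(e := T e) \<in> topes U L"
      using adjacent_tope_towards X assms(3) by blast
    let ?X = "X(e := T e)"
    have "cube_adj X ?X"
      unfolding cube_adj_def by (rule ex1I[of _ e]) (use e in \<open>auto split: if_splits\<close>)
    then have "e \<in> osc (topes U L) C" if "?X \<notin> C"
      unfolding osc_def using that e less.prems(1)
      by (intro CollectI bexI[of _ X] bexI[of _ ?X]) auto
    then have XC: "?X \<in> C" using less.prems(2) e(1) by metis
    have "e \<in> diff X T" using e by (simp add: diff_def)
    then have "card (diff ?X T) < card (diff X T)"
      using card_Diff1_less[OF finite_topes_diff[OF X assms(3)]] e(1) by (simp add: diff_upd)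
    then show ?thesis using less.hyps XC less.prems convex_one_side_of_osc[OF C _ less.prems(1) XC] by metis
  qed
qed

end

section \<open>From samples to convex sets\<close>

lemma osc_subset:
  assumes "C \<subseteq> topes U L"
  shows "osc (topes U L) C \<subseteq> U"
proof
  fix e assume "e \<in> osc (topes U L) C"
  then obtain X Y where "X \<in> topes U L" "Y \<in> topes U L" "X e \<noteq> Y e" using assms by (auto simp: osc_def)
  then show "e \<in> U" unfolding tope_iff by metis
qed

theorem theorem2:
  fixes U :: "'a set" and L :: "('a \<Rightarrow> sign) set"
  assumes "simple_oriented_matroid U L"
  shows "(\<exists>a. reconstructible_map U (topes U L) a) \<and>
    (\<exists>\<alpha> \<beta>. proper_unlabeled_compression_scheme U (topes U L) (vc_dim U (topes U L)) \<alpha> \<beta>)"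
proof (cases "topes U L = {}")
  case True
  then show ?thesis
    by (auto simp: reconstructible_map_def convex_sets_def proper_unlabeled_compression_scheme_def
        unlabeled_compression_scheme_def realizable_samples_def)
next
  case False
  then obtain T0 where T0: "T0 \<in> topes U L" by blast
  interpret simple_oriented_matroid U L by fact
  let ?V = "topes U L"
  obtain \<beta> where \<beta>: "\<And>s. support s \<subseteq> U \<Longrightarrow> \<exists>X\<in>L. s \<le> X \<Longrightarrow>
      \<exists>W\<subseteq>support s. shatters L W \<and> \<beta> W \<in> L \<and> s \<le> \<beta> W"
    using scheme_exists[OF oriented_matroid_axioms] by blast
  define \<alpha> where "\<alpha> s = (SOME W. W \<subseteq> support s \<and> shatters L W \<and> \<beta> W \<in> L \<and> s \<le> \<beta> W)" for s
  \<comment> \<open>A decoded covector need not be a tope. Filling its zeros from a fixed tope keeps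
    it above the sample and still dependent on \<open>W\<close> only.\<close>
  define \<gamma> where "\<gamma> W = composition (\<beta> W) T0" for W
  have \<alpha>: "\<alpha> s \<subseteq> support s" "\<alpha> s \<in> shattered_sets U ?V" "\<gamma> (\<alpha> s) \<in> ?V" "s \<le> \<gamma> (\<alpha> s)"
    if "s \<in> realizable_samples U ?V" for s
  proof -
    have sU: "support s \<subseteq> U" and "\<exists>X\<in>L. s \<le> X"
      using that by (auto simp: realizable_samples_def sign_vectors_def topes_def)
    from \<beta>[OF this] have *: "\<alpha> s \<subseteq> support s \<and> shatters L (\<alpha> s) \<and> \<beta> (\<alpha> s) \<in> L \<and> s \<le> \<beta> (\<alpha> s)"
      unfolding \<alpha>_def by (rule someI_ex)
    then show "\<alpha> s \<subseteq> support s" "\<gamma> (\<alpha> s) \<in> ?V"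
      using composition_tope[OF _ T0] by (auto simp: \<gamma>_def)
    have "\<beta> (\<alpha> s) \<le> \<gamma> (\<alpha> s)" by (auto simp: \<gamma>_def le_sign_vector_iff composition_def)
    with * show "s \<le> \<gamma> (\<alpha> s)" using order_trans by blast
    show "\<alpha> s \<in> shattered_sets U ?V"
      unfolding shattered_sets_def
    proof (intro CollectI conjI ballI)
      show "\<alpha> s \<subseteq> U" using * sU by blast
      fix Y assume "Y \<in> full_sign_vectors (\<alpha> s)"
      then have Y: "\<forall>w\<in>\<alpha> s. Y w \<noteq> Zero" by (auto simp: full_sign_vectors_def support_def)
      then obtain X where "X \<in> L" "\<forall>w\<in>\<alpha> s. X w = Y w"
        using * unfolding shatters_def by metis
      then show "\<exists>X\<in>?V. \<forall>e\<in>\<alpha> s. X e = Y e"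
        using composition_tope[OF _ T0] Y by (intro bexI[of _ "composition X T0"]) (auto simp: composition_def)
    qed
  qed
  have vc: "card W \<le> vc_dim U ?V" if "W \<in> shattered_sets U ?V" for W
  proof -
    have "finite (shattered_sets U ?V)"
      by (rule finite_subset[of _ "Pow U"]) (use finite_ground in \<open>auto simp: shattered_sets_def\<close>)
    then show ?thesis unfolding vc_dim_def using that by (intro Max_ge) auto
  qed
  have "proper_unlabeled_compression_scheme U ?V (vc_dim U ?V) \<alpha> \<gamma>"
    unfolding proper_unlabeled_compression_scheme_def unlabeled_compression_scheme_def
  proof (intro conjI ballI)
    fix s assume s: "s \<in> realizable_samples U ?V"
    show "\<alpha> s \<subseteq> U" using \<alpha>(2)[OF s] by (auto simp: shattered_sets_def)
    show "card (\<alpha> s) \<le> vc_dim U ?V" using vc[OF \<alpha>(2)[OF s]] .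
    show "\<alpha> s \<subseteq> support s" "s \<le> \<gamma> (\<alpha> s)" using \<alpha>[OF s] by auto
  next
    fix W assume "W \<in> \<alpha> ` realizable_samples U ?V"
    then show "\<gamma> W \<in> ?V" using \<alpha>(3) by blast
    then show "\<gamma> W \<in> full_sign_vectors U" by (auto simp: topes_def)
  qed
  moreover
  \<comment> \<open>The choice of the tope is immaterial: by \<open>convex_one_side_of_osc\<close>
    all members of \<open>C\<close> have the same signs on \<open>osc ?V C\<close>.\<close>
  define sample where "sample C = (\<lambda>e. if e \<in> osc ?V C then (SOME X. X \<in> C) e else Zero)" for C
  have sample: "support (sample C) = osc ?V C" "sample C \<in> realizable_samples U ?V"
    "\<And>T. T \<in> ?V \<Longrightarrow> sample C \<le> T \<Longrightarrow> T \<in> C" if C: "C \<in> convex_sets ?V" for C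
  proof -
    define X where "X = (SOME X. X \<in> C)"
    have XC: "X \<in> C" using C unfolding convex_sets_def X_def by (simp add: some_in_eq)
    have CV: "C \<subseteq> ?V" using C by (auto simp: convex_sets_def)
    have sC: "sample C = restr (osc ?V C) X" by (auto simp: sample_def X_def restr_def)
    have nz: "X e \<noteq> Zero" if "e \<in> osc ?V C" for e
      using that osc_subset[OF CV] XC CV by (metis subsetD tope_iff)
    then show supp: "support (sample C) = osc ?V C"
      by (auto simp: sC support_def restr_def)
    have "sample C \<le> X" by (auto simp: sC le_sign_vector_iff restr_def)
    then show "sample C \<in> realizable_samples U ?V"
      using supp osc_subset[OF CV] XC CV by (auto simp: realizable_samples_def sign_vectors_def)
    show "T \<in> C" if "T \<in> ?V" "sample C \<le> T" for T
    proof (rule convex_contains[OF C XC that(1)])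
      fix e assume "e \<in> osc ?V C"
      then show "T e = X e"
        using that(2)[unfolded le_sign_vector_iff, rule_format, of e] nz by (simp add: sC restr_def)
    qed
  qed
  have "reconstructible_map U ?V (\<lambda>C. \<alpha> (sample C))"
    unfolding reconstructible_map_def
  proof (intro conjI ballI)
    fix C assume "C \<in> convex_sets ?V"
    note s = sample(2)[OF this] and supp = sample(1)[OF this]
    show "\<alpha> (sample C) \<in> shattered_sets U ?V" using \<alpha>(2)[OF s] .
    show "\<alpha> (sample C) \<subseteq> osc ?V C" using \<alpha>(1)[OF s] supp by simp
  next
    fix W assume "W \<in> (\<lambda>C. \<alpha> (sample C)) ` convex_sets ?V"
    have "\<gamma> W \<in> C" if C: "C \<in> convex_sets ?V" "\<alpha> (sample C) = W" for C
      using sample(3)[OF C(1)] \<alpha>(3,4)[OF sample(2)[OF C(1)]] C(2) by metis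
    then show "\<Inter>{C \<in> convex_sets ?V. \<alpha> (sample C) = W} \<noteq> {}" by blast
  qed
  ultimately show ?thesis by blast
qed

end
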